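(* There exists $\tilde M>0$ such that for every $M>\tilde M$ the function $h\mapsto e_M(h)$ has a unique minimizer $h^*_M$ on $(0,+\infty)$.
   Context: Let $d\ge 2$, $|y|_1=\sum_i|y_i|$, $K_1(\zeta)=e^{-|\zeta|_1}/|\zeta|_1^{d-2}$, $\mathrm{Per}_1(E,[0,L)^d)=\int_{\partial E\cap[0,L)^d}|\nu^E|_1\,d\mathcal H^{d-1}$. For $J,L>0$ and $E$ $[0,L)^d$-periodic of locally finite perimeter, $\tilde{\mathcal F}_{J,L}(E)=\frac1{L^d}\big(J\,\mathrm{Per}_1(E,[0,L)^d)-\int_{[0,L)^d}\int_{\mathbb R^d}|\chi_E(x+\zeta)-\chi_E(x)|K_1(\zeta)d\zeta dx\big)$; $\tilde J_M=\int_{\mathbb R^{d-1}}\int_{-M}^M|\zeta_1|K_1(\zeta)d\zeta$; $e^*_M$ is the infimum of $\tilde{\mathcal F}_{\tilde J_M,L}(E)$ over all $L>0$ and all $[0,L)^d$-periodic unions of stripes (sets equal up to null sets to $\{x:x_i\in\hat E\}$, $\hat E\subset\mathbb R$ a locally finite union of intervals), negative for large $M$; $\bar K_M(\zeta)=-\frac{e^{-M|\zeta|_1}}{e^*_M|\zeta|_1^{d-2}}$; $J_M=\int_{\mathbb R^{d-1}}\int_{-1}^1|\zeta_1|\bar K_M(\zeta)d\zeta$; $\mathcal F_{M,L}(E)=\frac{M^2}{L^d}\big(J_M\mathrm{Per}_1(E,[0,L)^d)-\int_{[0,L)^d}\int_{\mathbb R^d}|\chi_E(x+\zeta)-\chi_E(x)|\bar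 K_M(\zeta)d\zeta dx\big)$. For $h>0$, $E_h=\bigcup_{j\in\mathbb Z}[2jh,(2j+1)h]\times\mathbb R^{d-1}$ and $e_M(h)=\mathcal F_{M,2h}(E_h)$. *)

theory Defs
  imports "HOL-Analysis.Analysis"
begin

text \<open>Space R^d is rendered as real^'n with d = CARD('n).
  The distinguished first coordinate (zeta_1, x_1) is the fixed index dir1.\<close>

definition dir1 :: "'n::finite" where
  "dir1 = (SOME i. True)"

definition norm1 :: "real^'n::finite \<Rightarrow> real" where
  "norm1 y = (\<Sum>j\<in>UNIV. \<bar>y $ j\<bar>)"

definition K1 :: "real^'n::finite \<Rightarrow> real" where
  "K1 \<zeta> = exp (- norm1 \<zeta>) / norm1 \<zeta> ^ (CARD('n) - 2)"

definition cube :: "real \<Rightarrow> (real^'n::finite) set" where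
  "cube L = {x. \<forall>j. 0 \<le> x $ j \<and> x $ j < L}"

definition periodic_set :: "real \<Rightarrow> (real^'n::finite) set \<Rightarrow> bool" where
  "periodic_set L E \<longleftrightarrow> (\<forall>x j. x \<in> E \<longleftrightarrow> x + L *\<^sub>R axis j 1 \<in> E)"

definition divergence :: "(real^'n::finite \<Rightarrow> real^'n) \<Rightarrow> real^'n \<Rightarrow> real" where
  "divergence \<phi> x = (\<Sum>j\<in>UNIV. frechet_derivative \<phi> (at x) (axis j 1) $ j)"

text \<open>C^1, [0,L)^d-periodic vector fields with sup-norm (dual of the 1-norm) at most 1.\<close>
definition per_test_fields :: "real \<Rightarrow> (real^'n::finite \<Rightarrow> real^'n) set" where
  "per_test_fields L = {\<phi>. (\<forall>x. \<phi> differentiable at x)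
      \<and> (\<forall>j. continuous_on UNIV (\<lambda>x. frechet_derivative \<phi> (at x) (axis j 1)))
      \<and> (\<forall>x j. \<phi> (x + L *\<^sub>R axis j 1) = \<phi> x)
      \<and> (\<forall>x j. \<bar>\<phi> x $ j\<bar> \<le> 1)}"

text \<open>Anisotropic (1-norm) perimeter of a periodic set in the torus [0,L)^d,
  via the distributional (total variation) definition.\<close>
definition Per1 :: "(real^'n::finite) set \<Rightarrow> real \<Rightarrow> real" where
  "Per1 E L = (SUP \<phi>\<in>per_test_fields L. (LINT x:E \<inter> cube L|lborel. divergence \<phi> x))"

definition nonlocal :: "(real^'n::finite \<Rightarrow> real) \<Rightarrow> (real^'n) set \<Rightarrow> real \<Rightarrow> real" where
  "nonlocal K E L = (LINT x:cube L|lborel.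
      (LINT \<zeta>|lborel. \<bar>indicator E (x + \<zeta>) - indicator E x\<bar> * K \<zeta>))"

definition Ftilde :: "real \<Rightarrow> real \<Rightarrow> (real^'n::finite) set \<Rightarrow> real" where
  "Ftilde J L E = (J * Per1 E L - nonlocal K1 E L) / L ^ CARD('n)"

definition Jtilde :: "'n::finite itself \<Rightarrow> real \<Rightarrow> real" where
  "Jtilde t M = (LINT \<zeta>|lborel. indicator {\<zeta>::real^'n. \<bar>\<zeta> $ dir1\<bar> \<le> M} \<zeta> * \<bar>\<zeta> $ dir1\<bar> * K1 \<zeta>)"

definition loc_fin_union_intervals :: "real set \<Rightarrow> bool" where
  "loc_fin_union_intervals S \<longleftrightarrow> (\<exists>\<I>. (\<forall>I\<in>\<I>. is_interval I) \<and> S = \<Union>\<I>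
      \<and> (\<forall>r. finite {I\<in>\<I>. I \<inter> {-r..r} \<noteq> {}}))"

definition stripe_union :: "(real^'n::finite) set \<Rightarrow> bool" where
  "stripe_union E \<longleftrightarrow> (\<exists>i S. loc_fin_union_intervals S \<and>
      (E - {x. x $ i \<in> S}) \<union> ({x. x $ i \<in> S} - E) \<in> null_sets lborel)"

definition estar :: "'n::finite itself \<Rightarrow> real \<Rightarrow> real" where
  "estar t M = Inf {Ftilde (Jtilde t M) L E | L (E::(real^'n) set).
      L > 0 \<and> periodic_set L E \<and> stripe_union E}"

definition Kbar :: "'n::finite itself \<Rightarrow> real \<Rightarrow> real^'n \<Rightarrow> real" where
  "Kbar t M \<zeta> = - exp (- M * norm1 \<zeta>) / (estar t M * norm1 \<zeta> ^ (CARD('n) - 2))"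

definition JM :: "'n::finite itself \<Rightarrow> real \<Rightarrow> real" where
  "JM t M = (LINT \<zeta>|lborel. indicator {\<zeta>::real^'n. \<bar>\<zeta> $ dir1\<bar> \<le> 1} \<zeta> * \<bar>\<zeta> $ dir1\<bar> * Kbar t M \<zeta>)"

definition FM :: "'n::finite itself \<Rightarrow> real \<Rightarrow> real \<Rightarrow> (real^'n) set \<Rightarrow> real" where
  "FM t M L E = M\<^sup>2 / L ^ CARD('n) * (JM t M * Per1 E L - nonlocal (Kbar t M) E L)"

definition Eh :: "real \<Rightarrow> (real^'n::finite) set" where
  "Eh h = {x. \<exists>j::int. 2 * of_int j * h \<le> x $ dir1 \<and> x $ dir1 \<le> (2 * of_int j + 1) * h}"

definition eM :: "'n::finite itself \<Rightarrow> real \<Rightarrow> real \<Rightarrow> real" where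
  "eM t M h = FM t M (2 * h) (Eh h :: (real^'n) set)"

end

theory Submission
  imports Defs "HOL-Probability.Probability"
begin

text \<open>For the periodic stripes of width \<open>h\<close> the energy is an explicit one-dimensional quantity.
  The kernel is a superposition of exponentials \<open>exp(-\<alpha>\<bar>\<zeta>\<bar>)\<close> (\<open>\<bar>\<cdot>\<bar>\<close> the 1-norm, \<open>\<alpha> \<ge> M\<close>),
  and each exponential contributes a multiple of \<open>tanh(\<alpha>h/2)\<close> to the nonlocal term, so up to a
  factor \<open>e_M(h) = (J - T(h))/h\<close> with \<open>T\<close> a positive superposition of the functions
  \<open>tanh(\<alpha>h/2)\<close>. Strict concavity of \<open>T\<close> gives uniqueness, since two minimizers
  would be beaten by their midpoint; \<open>T(h) = O(h)\<close>,
  boundedness of \<open>T\<close> and \<open>T(1) > J > 0\<close> give existence. The prefactor has the right sign because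
  \<open>e*_M < 0\<close> for every \<open>M > 0\<close>: stripes of width \<open>M\<close> already have negative energy, and the stripe
  energies are bounded below.\<close>

section \<open>Coordinatewise integration\<close>

text \<open>The obstacle in the kernel is the factor \<open>1/r^(d-2)\<close>, \<open>r\<close> the
  1-norm: unlike \<open>exp(-\<alpha> r)\<close> it does not split into functions of single
  coordinates. A Gamma integral removes it: for \<open>k = d - 2 > 0\<close>,
  \<open>exp(-m r)/r^k\<close> is the integral of \<open>exp(-\<alpha> r)\<close> against the
  density \<open>(\<alpha> - m)^(k-1)/(k-1)!\<close> on \<alpha> \<ge> m; for \<open>d = 2\<close>
  the measure is a Dirac mass at \<open>m\<close>. It is positive and nonzero, so strict
  inequalities valid for each \<alpha> survive integration. In particular \<open>J < T(R)\<close> at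
  the cutoff \<open>R\<close> reduces to \<open>1 - exp(-y)(1 + y) < tanh(y/2)\<close> with
  \<open>y = \<alpha> R\<close>. This is used twice: with \<open>m = 1\<close>, \<open>R = M\<close>
  for the sign of \<open>estar\<close>, and with \<open>m = M\<close>, \<open>R = 1\<close> for
  existence. The sign of \<open>estar\<close> takes more than a trial set: \<open>Inf\<close> in the
  reals is informative only for sets bounded below, and \<open>Per1\<close> is itself a real
  \<open>SUP\<close>, informative only for sets bounded above. So the test integrals must be bounded
  for every competing stripe union, including overlapping intervals and changes on a null
  set.\<close>

lemma product_sigma_finite_lborel: "product_sigma_finite (\<lambda>_::'i. lborel :: real measure)"
  by unfold_locales

lemma measurable_vec_lambda [measurable]:
  "vec_lambda \<in> (\<Pi>\<^sub>M j\<in>(UNIV::'n::finite set). (lborel :: real measure)) \<rightarrow>\<^sub>M borel"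
proof (rule borel_measurable_euclidean_space[THEN iffD2], rule ballI)
  fix b :: "real^'n" assume "b \<in> Basis"
  then obtain k where b: "b = axis k 1"
    by (auto simp: Basis_vec_def)
  show "(\<lambda>x. vec_lambda x \<bullet> b) \<in> borel_measurable (\<Pi>\<^sub>M j\<in>UNIV. lborel)"
    unfolding b inner_axis by simp
qed

text \<open>Lebesgue measure is determined by the volumes of boxes, and a box pulls back to a
  product of intervals. This carries product-measure Fubini over to \<open>real^'n\<close>.\<close>

lemma lborel_vec_eq:
  "(lborel :: (real^'n::finite) measure) = distr (\<Pi>\<^sub>M j\<in>UNIV. lborel) borel vec_lambda"
proof (rule lborel_eqI)
  interpret product_sigma_finite "\<lambda>_::'n. lborel :: real measure"
    by (rule product_sigma_finite_lborel)
  fix l u :: "real^'n"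
  assume le: "\<And>b. b \<in> Basis \<Longrightarrow> l \<bullet> b \<le> u \<bullet> b"
  have le': "l $ k \<le> u $ k" for k
    using le[of "axis k 1"] by (simp add: inner_axis axis_in_Basis_iff)
  have "vec_lambda -` box l u = Pi\<^sub>E UNIV (\<lambda>k. {l $ k <..< u $ k})"
    by (auto simp: mem_box_cart PiE_iff)
  then have "emeasure (distr (\<Pi>\<^sub>M j\<in>UNIV. lborel) borel vec_lambda) (box l u)
      = emeasure (\<Pi>\<^sub>M j\<in>(UNIV::'n set). lborel) (Pi\<^sub>E UNIV (\<lambda>k. {l $ k <..< u $ k}))"
    by (subst emeasure_distr) (auto simp: space_PiM)
  also have "\<dots> = (\<Prod>k\<in>UNIV. ennreal (u $ k - l $ k))"
    using le' by (subst emeasure_PiM) auto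
  also have "\<dots> = ennreal (\<Prod>k\<in>UNIV. u $ k - l $ k)"
    using le' by (intro prod_ennreal) auto
  also have "(\<Prod>k\<in>UNIV. u $ k - l $ k) = (\<Prod>b\<in>Basis. (u - l) \<bullet> b)"
  proof -
    have "(\<Prod>b\<in>Basis. (u - l) \<bullet> b) = (\<Prod>b\<in>(\<lambda>k. axis k 1) ` UNIV. (u - l) \<bullet> b)"
      by (rule prod.cong) (auto simp: Basis_vec_def)
    also have "\<dots> = (\<Prod>k\<in>UNIV. (u - l) \<bullet> axis k 1)"
      by (subst prod.reindex) (auto simp: inj_on_def axis_eq_axis)
    finally show ?thesis
      by (simp add: inner_axis)
  qed
  finally show "emeasure (distr (\<Pi>\<^sub>M j\<in>UNIV. lborel) borel vec_lambda) (box l u)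
      = ennreal (\<Prod>b\<in>Basis. (u - l) \<bullet> b)" .
qed simp

lemma nn_integral_vec_prod:
  fixes f :: "'n::finite \<Rightarrow> real \<Rightarrow> ennreal"
  assumes [measurable]: "\<And>j. f j \<in> borel_measurable borel"
  shows "(\<integral>\<^sup>+x. (\<Prod>j\<in>UNIV. f j (x $ j)) \<partial>lborel) = (\<Prod>j\<in>UNIV. (\<integral>\<^sup>+x. f j x \<partial>lborel))"
proof -
  interpret product_sigma_finite "\<lambda>_::'n. lborel :: real measure"
    by (rule product_sigma_finite_lborel)
  have "(\<integral>\<^sup>+x. (\<Prod>j\<in>UNIV. f j (x $ j)) \<partial>lborel)
      = (\<integral>\<^sup>+x. (\<Prod>j\<in>UNIV. f j (x j)) \<partial>(\<Pi>\<^sub>M j\<in>UNIV. lborel))"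
    by (subst lborel_vec_eq, subst nn_integral_distr) (simp_all add: measurable_vec_lambda)
  also have "\<dots> = (\<Prod>j\<in>UNIV. (\<integral>\<^sup>+x. f j x \<partial>lborel))"
    by (rule product_nn_integral_prod) auto
  finally show ?thesis .
qed

text \<open>The shape needed for stripes: one coordinate carries the pattern, and all others carry
  the same factor.\<close>

lemma nn_integral_vec_prod_single:
  fixes i :: "'n::finite" and f g :: "real \<Rightarrow> ennreal"
  assumes [measurable]: "f \<in> borel_measurable borel" "g \<in> borel_measurable borel"
  shows "(\<integral>\<^sup>+x. f (x $ i) * (\<Prod>j\<in>UNIV-{i}. g (x $ j)) \<partial>lborel)
    = (\<integral>\<^sup>+x. f x \<partial>lborel) * (\<integral>\<^sup>+x. g x \<partial>lborel) ^ (CARD('n) - 1)"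
proof -
  have "(\<integral>\<^sup>+x. f (x $ i) * (\<Prod>j\<in>UNIV-{i}. g (x $ j)) \<partial>lborel)
      = (\<integral>\<^sup>+x. (\<Prod>j\<in>UNIV. (if j = i then f else g) (x $ j)) \<partial>lborel)"
    by (subst prod.remove[of UNIV i]) auto
  also have "\<dots> = (\<Prod>j\<in>UNIV. (\<integral>\<^sup>+x. (if j = i then f else g) x \<partial>lborel))"
    using nn_integral_vec_prod[of "\<lambda>j. if j = i then f else g"] by simp
  also have "\<dots> = (\<integral>\<^sup>+x. f x \<partial>lborel) * (\<integral>\<^sup>+x. g x \<partial>lborel) ^ (CARD('n) - 1)"
    by (subst prod.remove[of UNIV i]) (auto simp: card_Diff_singleton)
  finally show ?thesis .
qed

text \<open>Fubini with coordinate \<open>i\<close> innermost, so that the fundamental theorem of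
  calculus can be applied along coordinate lines.\<close>

lemma integral_slice:
  fixes f :: "real^'n::finite \<Rightarrow> real"
  assumes "integrable lborel f"
  shows "integral\<^sup>L lborel f
    = (\<integral>x. (\<integral>y. f (vec_lambda (x(i := y))) \<partial>lborel) \<partial>(\<Pi>\<^sub>M j\<in>UNIV - {i}. lborel))"
proof -
  interpret product_sigma_finite "\<lambda>_::'n. lborel :: real measure"
    by (rule product_sigma_finite_lborel)
  have ins: "insert i (UNIV - {i}) = UNIV" by auto
  have meas: "f \<in> borel_measurable borel"
    using borel_measurable_integrable[OF assms] by simp
  have "integrable (distr (\<Pi>\<^sub>M j\<in>UNIV. lborel) borel vec_lambda) f"
    using assms by (subst lborel_vec_eq[symmetric])
  then have int: "integrable (\<Pi>\<^sub>M j\<in>(UNIV::'n set). lborel) (\<lambda>x. f (vec_lambda x))"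
    by (subst (asm) integrable_distr_eq) (use meas in \<open>auto simp: measurable_vec_lambda\<close>)
  have "integral\<^sup>L lborel f = (\<integral>x. f (vec_lambda x) \<partial>(\<Pi>\<^sub>M j\<in>(UNIV::'n set). lborel))"
    by (subst lborel_vec_eq, subst integral_distr) (use meas in \<open>auto simp: measurable_vec_lambda\<close>)
  also have "\<dots> = (\<integral>x. (\<integral>y. f (vec_lambda (x(i := y))) \<partial>lborel) \<partial>(\<Pi>\<^sub>M j\<in>UNIV - {i}. lborel))"
    using product_integral_insert[of "UNIV - {i}" i "\<lambda>x. f (vec_lambda x)"] int by (simp add: ins)
  finally show ?thesis .
qed

section \<open>The perimeter of stripes\<close>

lemma integral_derivative_Icc:
  fixes \<psi> :: "real \<Rightarrow> real"
  assumes "a \<le> b"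
    and der: "\<And>y. (\<psi> has_real_derivative \<psi>' y) (at y)"
    and cont: "continuous_on UNIV \<psi>'"
  shows "(\<integral>y. indicator {a..b} y * \<psi>' y \<partial>lborel) = \<psi> b - \<psi> a"
proof -
  have "(\<integral>y. indicator {a..b} y *\<^sub>R \<psi>' y \<partial>lborel) = \<psi> b - \<psi> a"
  proof (rule integral_FTC_atLeastAtMost[OF \<open>a \<le> b\<close>])
    show "(\<psi> has_vector_derivative \<psi>' y) (at y within {a..b})" for y
      using der[of y] has_vector_derivative_at_within
      by (simp add: has_real_derivative_iff_has_vector_derivative)
    show "continuous_on {a..b} \<psi>'"
      using cont by (rule continuous_on_subset) simp
  qed
  then show ?thesis by simp
qed

text \<open>The integral is a difference of two values of \<psi>, each of modulus at most 1.
  \<open>I\<close> may or may not contain its endpoints, so it is compared with the closed interval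
  from \<open>Inf I\<close> to \<open>Sup I\<close> up to a null set.\<close>

lemma interval_integral_derivative_bound:
  fixes \<psi> :: "real \<Rightarrow> real"
  assumes I: "is_interval I" "I \<subseteq> {a..b}"
    and der: "\<And>y. (\<psi> has_real_derivative \<psi>' y) (at y)"
    and cont: "continuous_on UNIV \<psi>'"
    and bd: "\<And>y. \<bar>\<psi> y\<bar> \<le> 1"
  shows "\<bar>\<integral>y. indicator I y * \<psi>' y \<partial>lborel\<bar> \<le> 2"
proof (cases "I = {}")
  case False
  define c d where "c = Inf I" and "d = Sup I"
  have bdd: "bdd_below I" "bdd_above I"
    using I(2) by (meson bdd_below_Icc bdd_below_mono, meson bdd_above_Icc bdd_above_mono)
  have sub: "I \<subseteq> {c..d}"
    using bdd by (auto simp: c_def d_def intro: cInf_lower cSup_upper)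
  have sup: "{c<..<d} \<subseteq> I"
  proof
    fix y assume "y \<in> {c<..<d}"
    then obtain u v where "u \<in> I" "u < y" "v \<in> I" "y < v"
      using False bdd by (auto simp: c_def d_def cInf_less_iff less_cSup_iff)
    then show "y \<in> I"
      using I(1) by (meson less_imp_le is_interval_1)
  qed
  have cd: "c \<le> d"
    using sub False by auto
  have mI: "I \<in> sets borel"
    using real_interval_borel_measurable[OF I(1)] .
  have "AE y in lborel. y \<noteq> c \<and> y \<noteq> d"
    using AE_lborel_singleton[of c] AE_lborel_singleton[of d] by auto
  then have "AE y in lborel. indicator I y * \<psi>' y = indicator {c..d} y * \<psi>' y"
  proof eventually_elim
    case (elim y)
    have "y \<in> I \<longleftrightarrow> y \<in> {c..d}"
    proof
      assume "y \<in> {c..d}"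
      with elim have "y \<in> {c<..<d}" by simp
      then show "y \<in> I" using sup by blast
    qed (use sub in blast)
    then show ?case by (simp only: indicator_def)
  qed
  moreover have "\<psi>' \<in> borel_measurable borel"
    by (rule borel_measurable_continuous_onI[OF cont])
  ultimately have "(\<integral>y. indicator I y * \<psi>' y \<partial>lborel) = (\<integral>y. indicator {c..d} y * \<psi>' y \<partial>lborel)"
    by (intro integral_cong_AE) (use mI in \<open>auto\<close>)
  also have "\<dots> = \<psi> d - \<psi> c"
    by (rule integral_derivative_Icc[OF cd der cont])
  finally show ?thesis
    using bd[of c] bd[of d] by linarith
qed auto

lemma vec_lambda_upd: "vec_lambda (x(j := y)) = vec_lambda (x(j := 0)) + y *\<^sub>R axis j (1::real)"
  by (simp add: vec_eq_iff axis_def)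

lemma continuous_on_vec_lambda_upd: "continuous_on UNIV (\<lambda>y::real. vec_lambda (x(j := y)))"
  by (subst vec_lambda_upd) (intro continuous_intros)

lemma per_test_fields_slice_deriv:
  assumes "\<phi> \<in> per_test_fields L"
  shows "((\<lambda>y. \<phi> (vec_lambda (x(j := y))) $ k) has_real_derivative
      frechet_derivative \<phi> (at (vec_lambda (x(j := y)))) (axis j 1) $ k) (at y)"
proof -
  define v where "v = vec_lambda (x(j := 0))"
  let ?D = "frechet_derivative \<phi> (at (v + y *\<^sub>R axis j 1))"
  have d: "(\<phi> has_derivative ?D) (at (v + y *\<^sub>R axis j 1))"
    using assms by (simp add: per_test_fields_def frechet_derivative_works[symmetric])
  then have lin: "linear ?D"
    by (rule has_derivative_linear)
  have "((\<lambda>y. v + y *\<^sub>R axis j 1) has_derivative (\<lambda>t. t *\<^sub>R axis j 1)) (at y)"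
    by (auto intro!: derivative_eq_intros)
  from has_derivative_compose[OF this d]
  have "((\<lambda>y. \<phi> (v + y *\<^sub>R axis j 1) $ k) has_derivative (\<lambda>t. ?D (t *\<^sub>R axis j 1) $ k)) (at y)"
    by (rule bounded_linear.has_derivative[OF bounded_linear_vec_nth])
  moreover have "(\<lambda>t. ?D (t *\<^sub>R axis j 1) $ k) = (*) (?D (axis j 1) $ k)"
    by (rule ext) (simp add: linear_scale[OF lin])
  moreover have "vec_lambda (x(j := y)) = v + y *\<^sub>R axis j 1" for y
    unfolding v_def by (rule vec_lambda_upd)
  ultimately show ?thesis
    by (simp add: has_field_derivative_def)
qed

lemma cube_borel [measurable]: "cube L \<in> sets borel"
  unfolding cube_def by measurable

lemma cube_integrable:
  fixes g :: "real^'n::finite \<Rightarrow> real"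
  assumes "continuous_on UNIV g" "A \<in> sets borel" "A \<subseteq> cube L"
  shows "integrable lborel (\<lambda>x. indicator A x * g x)"
proof -
  have "set_integrable lborel (cbox 0 (\<chi> j. L)) g"
    unfolding set_integrable_def
    by (intro borel_integrable_compact compact_cbox continuous_on_subset[OF assms(1)]) auto
  moreover have "A \<subseteq> cbox 0 (\<chi> j. L)"
    using assms(3) by (auto simp: cube_def mem_box_cart subset_iff less_imp_le)
  ultimately have "set_integrable lborel A g"
    using assms(2) by (auto intro: set_integrable_subset)
  then show ?thesis
    by (simp add: set_integrable_def)
qed

text \<open>Integrate along direction \<open>j\<close> first. Across the stripe
  (\<open>j = i\<close>) each slice is an interval and contributes at most 2, over a cross section
  of measure \<open>L ^ (d - 1)\<close>. Along the stripe each slice is empty or a full period,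
  where periodicity of \<phi> gives 0.\<close>

lemma partial_derivative_stripe_bound:
  fixes \<phi> :: "real^'n::finite \<Rightarrow> real^'n"
  assumes \<phi>: "\<phi> \<in> per_test_fields L" and L: "L > 0" and I: "is_interval I"
  shows "\<bar>\<integral>x. indicator (cube L \<inter> {x. x $ i \<in> I}) x * frechet_derivative \<phi> (at x) (axis j 1) $ j \<partial>lborel\<bar>
    \<le> (if j = i then 2 * L ^ (CARD('n) - 1) else 0)"
proof -
  interpret product_sigma_finite "\<lambda>_::'n. lborel :: real measure"
    by (rule product_sigma_finite_lborel)
  define D where "D = (\<lambda>x. frechet_derivative \<phi> (at x) (axis j 1) $ j)"
  define A where "A = cube L \<inter> {x::real^'n. x $ i \<in> I}"
  define P where "P = (\<Pi>\<^sub>M j\<in>UNIV - {j}. lborel :: real measure)"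
  define Q where "Q = Pi\<^sub>E (UNIV - {j}) (\<lambda>_. {0..<L})"
  have [measurable]: "I \<in> sets borel"
    using real_interval_borel_measurable[OF I] .
  have A: "A \<in> sets borel" "A \<subseteq> cube L"
    unfolding A_def by (auto simp: cube_borel) measurable
  have contD: "continuous_on UNIV D"
    using \<phi> by (auto simp: D_def per_test_fields_def intro!: continuous_intros)
  have per: "\<phi> (vec_lambda (x(j := L))) = \<phi> (vec_lambda (x(j := 0)))" for x
    using \<phi> by (simp add: vec_lambda_upd[of x j L] per_test_fields_def)
  let ?\<psi> = "\<lambda>x y. \<phi> (vec_lambda (x(j := y))) $ j"
  let ?\<psi>' = "\<lambda>x y. D (vec_lambda (x(j := y)))"
  have cont: "continuous_on UNIV (?\<psi>' x)" for x
    by (rule continuous_on_compose2[OF contD continuous_on_vec_lambda_upd]) auto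
  have der: "(?\<psi> x has_real_derivative ?\<psi>' x y) (at y)" for x y
    unfolding D_def by (rule per_test_fields_slice_deriv[OF \<phi>])
  have bd: "\<bar>?\<psi> x y\<bar> \<le> 1" for x y
    using \<phi> by (simp add: per_test_fields_def)
  have full: "(\<integral>y. indicator {0..<L} y * ?\<psi>' x y \<partial>lborel) = 0" for x
  proof -
    have "AE y in lborel. y \<noteq> L"
      by (rule AE_lborel_singleton)
    then have "AE y in lborel. indicator {0..<L} y * ?\<psi>' x y = indicator {0..L} y * ?\<psi>' x y"
      by eventually_elim (auto simp: indicator_def)
    then have "(\<integral>y. indicator {0..<L} y * ?\<psi>' x y \<partial>lborel) = (\<integral>y. indicator {0..L} y * ?\<psi>' x y \<partial>lborel)"
      using borel_measurable_continuous_onI[OF cont] by (intro integral_cong_AE) auto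
    also have "\<dots> = ?\<psi> x L - ?\<psi> x 0"
      by (rule integral_derivative_Icc[OF less_imp_le[OF L] der cont])
    finally show ?thesis
      by (simp add: per)
  qed
  have inner: "\<bar>\<integral>y. indicator A (vec_lambda (x(j := y))) * ?\<psi>' x y \<partial>lborel\<bar>
      \<le> (if j = i then 2 * indicator Q x else 0)" if x: "x \<in> space P" for x
  proof -
    have xQ: "x \<in> Q \<longleftrightarrow> (\<forall>k. k \<noteq> j \<longrightarrow> 0 \<le> x k \<and> x k < L)"
      using x by (auto simp: Q_def P_def space_PiM PiE_iff)
    have mem: "vec_lambda (x(j := y)) \<in> cube L \<longleftrightarrow> x \<in> Q \<and> 0 \<le> y \<and> y < L" for y
    proof -
      have "vec_lambda (x(j := y)) \<in> cube L \<longleftrightarrow> (\<forall>k. 0 \<le> (x(j := y)) k \<and> (x(j := y)) k < L)"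
        by (simp add: cube_def)
      also have "\<dots> \<longleftrightarrow> x \<in> Q \<and> 0 \<le> y \<and> y < L"
        unfolding xQ by (metis fun_upd_apply)
      finally show ?thesis .
    qed
    show ?thesis
    proof (cases "j = i")
      case True
      have "vec_lambda (x(j := y)) \<in> A \<longleftrightarrow> x \<in> Q \<and> y \<in> {0..<L} \<inter> I" for y
        unfolding A_def Int_iff mem using True by auto
      then have "indicator A (vec_lambda (x(j := y))) = indicator Q x * (indicator ({0..<L} \<inter> I) y :: real)" for y
        by (simp add: indicator_def)
      moreover have "\<bar>\<integral>y. indicator ({0..<L} \<inter> I) y * ?\<psi>' x y \<partial>lborel\<bar> \<le> 2"
      proof (rule interval_integral_derivative_bound[where a=0 and b=L and \<psi>="?\<psi> x"])
        show "is_interval ({0..<L} \<inter> I)"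
          by (intro is_interval_Int is_interval_co I)
        show "{0..<L} \<inter> I \<subseteq> {0..L}" by auto
      qed (rule der cont bd)+
      ultimately show ?thesis
        using True by (auto simp: indicator_def)
    next
      case False
      define c :: real where "c = (if x i \<in> I \<and> x \<in> Q then 1 else 0)"
      have "vec_lambda (x(j := y)) \<in> A \<longleftrightarrow> x \<in> Q \<and> y \<in> {0..<L} \<and> x i \<in> I" for y
        unfolding A_def Int_iff mem using False by auto
      then have "indicator A (vec_lambda (x(j := y))) = c * (indicator {0..<L} y :: real)" for y
        by (auto simp: indicator_def c_def)
      then have "(\<integral>y. indicator A (vec_lambda (x(j := y))) * ?\<psi>' x y \<partial>lborel)
          = c * (\<integral>y. indicator {0..<L} y * ?\<psi>' x y \<partial>lborel)"
        by (simp add: mult.assoc)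
      with full False show ?thesis by simp
    qed
  qed
  have Q: "emeasure P Q = ennreal (L ^ (CARD('n) - 1))" "Q \<in> sets P"
    unfolding P_def Q_def using L
    by (subst emeasure_PiM) (auto simp: card_Diff_singleton ennreal_power intro!: sets_PiM_I_finite)
  have "(\<integral>x. indicator A x * D x \<partial>lborel) = (\<integral>x. (\<integral>y. indicator A (vec_lambda (x(j := y))) * ?\<psi>' x y \<partial>lborel) \<partial>P)"
    unfolding P_def by (rule integral_slice[OF cube_integrable[OF contD A]])
  also have "\<bar>\<dots>\<bar> \<le> (\<integral>x. \<bar>\<integral>y. indicator A (vec_lambda (x(j := y))) * ?\<psi>' x y \<partial>lborel\<bar> \<partial>P)"
    by (rule integral_abs_bound)
  also have "\<dots> \<le> (\<integral>x. (if j = i then 2 * indicator Q x else 0) \<partial>P)"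
  proof (rule integral_mono')
    have "integrable P (indicator Q :: _ \<Rightarrow> real)"
      using Q by (intro integrable_real_indicator) auto
    then show "integrable P (\<lambda>x. if j = i then 2 * indicator Q x else 0 :: real)"
      by (cases "j = i") auto
  qed (use inner in auto)
  also have "\<dots> = (if j = i then 2 * L ^ (CARD('n) - 1) else 0)"
    using Q L by (auto simp: measure_def)
  finally show ?thesis
    by (simp add: A_def D_def)
qed

lemma divergence_stripe_bound:
  fixes \<phi> :: "real^'n::finite \<Rightarrow> real^'n"
  assumes \<phi>: "\<phi> \<in> per_test_fields L" and L: "L > 0" and I: "is_interval I"
  shows "\<bar>\<integral>x. indicator (cube L \<inter> {x. x $ i \<in> I}) x * divergence \<phi> x \<partial>lborel\<bar> \<le> 2 * L ^ (CARD('n) - 1)"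
proof -
  let ?A = "cube L \<inter> {x::real^'n. x $ i \<in> I}"
  let ?D = "\<lambda>j x. frechet_derivative \<phi> (at x) (axis j 1) $ j"
  have [measurable]: "I \<in> sets borel"
    using real_interval_borel_measurable[OF I] .
  have A: "?A \<in> sets borel" by measurable
  have "integrable lborel (\<lambda>x. indicator ?A x * ?D j x)" for j
    by (rule cube_integrable[OF _ A]) (use \<phi> in \<open>auto simp: per_test_fields_def intro!: continuous_intros\<close>)
  then have "(\<integral>x. indicator ?A x * divergence \<phi> x \<partial>lborel) = (\<Sum>j\<in>UNIV. \<integral>x. indicator ?A x * ?D j x \<partial>lborel)"
    unfolding divergence_def sum_distrib_left by (intro Bochner_Integration.integral_sum)
  also have "\<bar>\<dots>\<bar> \<le> (\<Sum>j\<in>UNIV. \<bar>\<integral>x. indicator ?A x * ?D j x \<partial>lborel\<bar>)"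
    by (rule sum_abs)
  also have "\<dots> \<le> (\<Sum>j\<in>UNIV. if j = i then 2 * L ^ (CARD('n) - 1) else 0)"
    by (intro sum_mono partial_derivative_stripe_bound assms)
  finally show ?thesis by simp
qed

section \<open>Perimeter of general unions of stripes\<close>

lemma divergence_continuous:
  assumes "\<phi> \<in> per_test_fields L"
  shows "continuous_on UNIV (divergence \<phi>)"
  unfolding divergence_def[abs_def]
  using assms by (auto simp: per_test_fields_def intro!: continuous_intros)

text \<open>Only the existence of a bound uniform in \<phi> matters. The intervals may overlap, so
  one interval \<open>I\<close> is removed by inclusion-exclusion; the correction term is the union
  of the sets \<open>J \<inter> I\<close>, again at most \<open>n\<close> intervals. Inducting on a
  bound for the cardinality, for all families at once, covers both smaller families.\<close>

lemma divergence_finite_union_bound: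
  fixes i :: "'n::finite"
  assumes L: "L > 0" and "finite F" "card F \<le> n" "\<And>I. I \<in> F \<Longrightarrow> is_interval I"
  shows "\<exists>C. \<forall>\<phi>\<in>per_test_fields L.
    \<bar>\<integral>x. indicator (cube L \<inter> {x::real^'n. x $ i \<in> \<Union>F}) x * divergence \<phi> x \<partial>lborel\<bar> \<le> C"
  using assms(2-)
proof (induction n arbitrary: F)
  case 0
  then have "F = {}" by simp
  then show ?case by auto
next
  case (Suc n)
  show ?case
  proof (cases "F = {}")
    case False
    then obtain I G where F: "F = insert I G" "I \<notin> G"
      by (meson ex_in_conv mk_disjoint_insert)
    let ?H = "(\<lambda>J. J \<inter> I) ` G"
    have G: "finite G" "card G \<le> n"
      using Suc.prems F by auto
    have H: "finite ?H" "card ?H \<le> n"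
      using G card_image_le[OF G(1)] by (auto intro: order.trans)
    have intG: "\<And>J. J \<in> G \<Longrightarrow> is_interval J" and intI: "is_interval I"
      using Suc.prems F by auto
    have intH: "\<And>J. J \<in> ?H \<Longrightarrow> is_interval J"
      using intG intI by (auto intro: is_interval_Int)
    obtain C1 where C1: "\<And>\<phi>. \<phi> \<in> per_test_fields L \<Longrightarrow>
        \<bar>\<integral>x. indicator (cube L \<inter> {x::real^'n. x $ i \<in> \<Union>G}) x * divergence \<phi> x \<partial>lborel\<bar> \<le> C1"
      using Suc.IH[OF G intG] by blast
    obtain C2 where C2: "\<And>\<phi>. \<phi> \<in> per_test_fields L \<Longrightarrow>
        \<bar>\<integral>x. indicator (cube L \<inter> {x::real^'n. x $ i \<in> \<Union>?H}) x * divergence \<phi> x \<partial>lborel\<bar> \<le> C2"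
      using Suc.IH[OF H intH] by blast
    show ?thesis
    proof (intro exI ballI)
      fix \<phi> :: "real^'n \<Rightarrow> real^'n" assume \<phi>: "\<phi> \<in> per_test_fields L"
      let ?f = "\<lambda>S x. indicator (cube L \<inter> {x::real^'n. x $ i \<in> S}) x * divergence \<phi> x"
      have Un: "\<Union>K \<in> sets borel" if "finite K" "\<And>J. J \<in> K \<Longrightarrow> is_interval J" for K :: "real set set"
        using that by (intro sets.finite_Union) (auto intro: real_interval_borel_measurable)
      have int: "integrable lborel (?f S)" if [measurable]: "S \<in> sets borel" for S
        by (rule cube_integrable[OF divergence_continuous[OF \<phi>], of _ L]) auto
      have iG: "integrable lborel (?f (\<Union>G))" and iI: "integrable lborel (?f I)"
        and iH: "integrable lborel (?f (\<Union>?H))"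
        using G H intG intH intI by (intro int Un; auto intro: real_interval_borel_measurable)+
      have "?f (\<Union>F) x = ?f (\<Union>G) x + ?f I x - ?f (\<Union>?H) x" for x
      proof (cases "x \<in> cube L")
        case True
        show ?thesis
          by (cases "x $ i \<in> I"; cases "x $ i \<in> \<Union>G") (use True in \<open>auto simp: F indicator_def\<close>)
      qed simp
      then have "(\<integral>x. ?f (\<Union>F) x \<partial>lborel)
          = (\<integral>x. ?f (\<Union>G) x \<partial>lborel) + (\<integral>x. ?f I x \<partial>lborel) - (\<integral>x. ?f (\<Union>?H) x \<partial>lborel)"
        using iG iI iH by simp
      then show "\<bar>\<integral>x. ?f (\<Union>F) x \<partial>lborel\<bar> \<le> C1 + 2 * L ^ (CARD('n) - 1) + C2"
        using C1[OF \<phi>] C2[OF \<phi>] divergence_stripe_bound[OF \<phi> L intI, of i] by linarith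
    qed
  next
    case True
    show ?thesis
      unfolding True by (rule exI[of _ 0]) simp
  qed
qed

lemma per_test_fields_zero: "(\<lambda>_. 0) \<in> per_test_fields L"
  by (simp add: per_test_fields_def frechet_derivative_const)

text \<open>The zero field has test value 0, but \<open>cSUP_upper\<close> requires the set of test
  values to be bounded above; that is the real content.\<close>

lemma stripe_union_Per1_nonneg:
  fixes E :: "(real^'n::finite) set"
  assumes E: "stripe_union E" and L: "L > 0"
  shows "Per1 E L \<ge> 0"
proof -
  from E obtain i S where S: "loc_fin_union_intervals S"
    and "(E - {x. x $ i \<in> S}) \<union> ({x. x $ i \<in> S} - E) \<in> null_sets lborel"
    unfolding stripe_union_def by blast
  define N where "N = (E - {x. x $ i \<in> S}) \<union> ({x. x $ i \<in> S} - E)"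
  have N: "N \<in> null_sets lborel"
    unfolding N_def by fact
  obtain \<I> where I: "\<And>I. I \<in> \<I> \<Longrightarrow> is_interval I" "S = \<Union>\<I>"
      and fin: "\<And>r. finite {I\<in>\<I>. I \<inter> {-r..r} \<noteq> {}}"
    using S unfolding loc_fin_union_intervals_def by blast
  \<comment> \<open>Only intervals meeting \<open>{-L..L}\<close>, which contains the coordinate
    range of \<open>cube L\<close>, are seen by the cube; local finiteness leaves finitely
    many.\<close>
  define F where "F = {I\<in>\<I>. I \<inter> {-L..L} \<noteq> {}}"
  define A where "A = cube L \<inter> {x::real^'n. x $ i \<in> \<Union>F}"
  have F: "finite F" "\<And>I. I \<in> F \<Longrightarrow> is_interval I"
    using fin[of L] I by (auto simp: F_def)
  have [measurable]: "\<Union>F \<in> sets borel"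
    using F by (intro sets.finite_Union) (auto intro: real_interval_borel_measurable)
  have A: "A \<in> sets borel"
    unfolding A_def by measurable
  have key: "x $ i \<in> S \<longleftrightarrow> x $ i \<in> \<Union>F" if "x \<in> cube L" for x :: "real^'n"
  proof -
    have "x $ i \<in> {-L..L}"
      using that L by (simp add: cube_def less_imp_le) (smt (verit))
    then show ?thesis
      unfolding I(2) F_def by blast
  qed
  have EN: "x \<in> E \<inter> cube L \<longleftrightarrow> x \<in> A" if "x \<notin> N" for x
    using that key by (auto simp: N_def A_def)
  \<comment> \<open>Measurability of \<open>E\<close> is not given but derived: \<open>N\<close>
    lies in \<open>null_sets lborel\<close>, hence is Borel, and inside the cube \<open>E\<close> is
    the symmetric difference of \<open>A\<close> and \<open>N\<close>.\<close>
  have "x \<in> E \<inter> cube L \<longleftrightarrow> x \<in> (A - N) \<union> ((cube L \<inter> N) - A)" for x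
    using key[of x] unfolding N_def A_def by blast
  then have "E \<inter> cube L = (A - N) \<union> ((cube L \<inter> N) - A)"
    by (rule set_eqI)
  moreover have "N \<in> sets borel"
    using N by (auto dest: null_setsD2)
  ultimately have EL [measurable]: "E \<inter> cube L \<in> sets borel"
    using A by auto
  have AE: "AE x in lborel. x \<notin> N"
    using N by (rule AE_not_in)
  obtain C where C: "\<And>\<phi>. \<phi> \<in> per_test_fields L \<Longrightarrow>
      \<bar>\<integral>x. indicator A x * divergence \<phi> x \<partial>lborel\<bar> \<le> C"
    using divergence_finite_union_bound[OF L F(1) order_refl F(2), of i] unfolding A_def by blast
  let ?T = "\<lambda>\<phi>. LINT x:E \<inter> cube L|lborel. divergence \<phi> x"
  have eq: "?T \<phi> = (\<integral>x. indicator A x * divergence \<phi> x \<partial>lborel)" if "\<phi> \<in> per_test_fields L" for \<phi>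
  proof -
    have [measurable]: "divergence \<phi> \<in> borel_measurable borel"
      by (rule borel_measurable_continuous_onI[OF divergence_continuous[OF that]])
    have "AE x in lborel. indicator (E \<inter> cube L) x *\<^sub>R divergence \<phi> x = indicator A x * divergence \<phi> x"
      using AE
    proof eventually_elim
      case (elim x)
      show ?case
        using EN[OF elim] by (simp add: indicator_def)
    qed
    then show ?thesis
      unfolding set_lebesgue_integral_def using EL A by (intro integral_cong_AE) auto
  qed
  have "bdd_above (?T ` per_test_fields L)"
  proof (rule bdd_aboveI2)
    fix \<phi> :: "real^'n \<Rightarrow> real^'n" assume "\<phi> \<in> per_test_fields L"
    with C[OF this] eq[OF this] show "?T \<phi> \<le> C" by simp
  qed
  then have "?T (\<lambda>_. 0) \<le> Per1 E L"
    unfolding Per1_def by (rule cSUP_upper[OF per_test_fields_zero])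
  moreover have "?T (\<lambda>_. 0) = 0"
    by (simp add: divergence_def frechet_derivative_const)
  ultimately show ?thesis by simp
qed

section \<open>Exact perimeter of stripes of width \<open>h\<close>\<close>

lemma Eh_Int_cube:
  assumes "h > 0"
  shows "(Eh h :: (real^'n::finite) set) \<inter> cube (2 * h) = cube (2 * h) \<inter> {x. x $ dir1 \<in> {0..h}}"
proof -
  have "x $ dir1 \<in> {0..h}" if x: "x \<in> Eh h" "x \<in> cube (2 * h)" for x :: "real^'n"
  proof -
    obtain j :: int where j: "2 * of_int j * h \<le> x $ dir1" "x $ dir1 \<le> (2 * of_int j + 1) * h"
      using x(1) unfolding Eh_def by blast
    have x': "0 \<le> x $ dir1" "x $ dir1 < 2 * h"
      using x(2) by (auto simp: cube_def)
    \<comment> \<open>The half-open cube excludes \<open>x $ dir1 = 2 * h\<close>, where the stripe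
      with \<open>j = 1\<close> begins.\<close>
    have "2 * of_int j * h < 2 * h" "0 \<le> (2 * of_int j + 1) * h"
      using j x' by linarith+
    then have "real_of_int j < 1" "0 \<le> 2 * real_of_int j + 1"
      using assms by (auto simp: zero_le_mult_iff mult_less_cancel_right)
    then have "j = 0" by linarith
    with j show ?thesis by simp
  qed
  moreover have "x \<in> Eh h" if "x $ dir1 \<in> {0..h}" for x :: "real^'n"
    unfolding Eh_def using that by (auto intro!: exI[of _ 0])
  ultimately show ?thesis by blast
qed

lemma indicator_cube:
  "indicator (cube L) x = (\<Prod>j\<in>UNIV. indicator {0..<L} (x $ j) :: 'a::{idom})"
proof (cases "x \<in> cube L")
  case False
  then obtain j where "x $ j \<notin> {0..<L}"
    by (auto simp: cube_def not_less not_le)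
  then have "indicator {0..<L} (x $ j) = (0 :: 'a)"
    by (rule indicator_simps(2))
  then have "(\<Prod>j\<in>UNIV. indicator {0..<L} (x $ j) :: 'a) = 0"
    by (intro prod_zero) auto
  with False show ?thesis by simp
qed (auto simp: cube_def intro!: prod.neutral)

lemma nn_integral_cube_coordinate:
  fixes f :: "real \<Rightarrow> ennreal" and i :: "'n::finite"
  assumes [measurable]: "f \<in> borel_measurable borel" and L: "L > 0"
  shows "(\<integral>\<^sup>+(x::real^'n). indicator (cube L) x * f (x $ i) \<partial>lborel)
    = ennreal (L ^ (CARD('n) - 1)) * (\<integral>\<^sup>+y. indicator {0..<L} y * f y \<partial>lborel)"
proof -
  have "(indicator (cube L) x :: ennreal) = indicator {0..<L} (x $ i) * (\<Prod>j\<in>UNIV-{i}. indicator {0..<L} (x $ j))"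
    for x :: "real^'n"
  proof -
    have "(indicator (cube L) x :: ennreal) = ennreal (indicator (cube L) x)"
      by (simp only: ennreal_indicator)
    also have "\<dots> = ennreal (indicator {0..<L} (x $ i)) * (\<Prod>j\<in>UNIV-{i}. ennreal (indicator {0..<L} (x $ j)))"
      unfolding indicator_cube by (subst prod.remove[of UNIV i]) (auto simp: ennreal_mult'' prod_nonneg prod_ennreal)
    finally show ?thesis by (simp only: ennreal_indicator)
  qed
  then have "(\<integral>\<^sup>+(x::real^'n). indicator (cube L) x * f (x $ i) \<partial>lborel)
      = (\<integral>\<^sup>+(x::real^'n). (\<lambda>y. indicator {0..<L} y * f y) (x $ i) * (\<Prod>j\<in>UNIV-{i}. indicator {0..<L} (x $ j)) \<partial>lborel)"
    by (simp add: mult_ac)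
  also have "\<dots> = (\<integral>\<^sup>+y. indicator {0..<L} y * f y \<partial>lborel) * (\<integral>\<^sup>+y. indicator {0..<L} y \<partial>lborel) ^ (CARD('n) - 1)"
    by (rule nn_integral_vec_prod_single) auto
  also have "(\<integral>\<^sup>+y. indicator {0..<L} y \<partial>lborel) = ennreal L"
    using L by (subst nn_integral_indicator) auto
  finally show ?thesis
    using L by (simp add: ennreal_power mult.commute)
qed

lemma emeasure_cube:
  assumes "L > 0"
  shows "emeasure lborel (cube L :: (real^'n::finite) set) = ennreal (L ^ CARD('n))"
proof -
  have "emeasure lborel (cube L :: (real^'n) set) = (\<integral>\<^sup>+(x::real^'n). indicator (cube L) x * 1 \<partial>lborel)"
    by (simp add: cube_borel)
  also have "\<dots> = ennreal (L ^ (CARD('n) - 1)) * (\<integral>\<^sup>+y. indicator {0..<L} y * 1 \<partial>lborel)"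
    by (rule nn_integral_cube_coordinate) (use assms in auto)
  also have "(\<integral>\<^sup>+y. indicator {0..<L} y * 1 \<partial>lborel) = ennreal L"
    using assms by simp
  also have "ennreal (L ^ (CARD('n) - 1)) * ennreal L = ennreal (L ^ CARD('n))"
    using assms by (subst ennreal_mult[symmetric]) (auto simp del: One_nat_def simp: power_minus_mult)
  finally show ?thesis .
qed

text \<open>The supremum is attained: \<open>divergence_stripe_bound\<close> bounds it from above,
  and a cosine field calibrates both faces of the stripe.\<close>

lemma Per1_Eh:
  assumes h: "h > 0"
  shows "Per1 (Eh h :: (real^'n::finite) set) (2 * h) = 2 * (2 * h) ^ (CARD('n) - 1)"
  unfolding Per1_def
proof (rule cSup_eq_maximum)
  let ?A = "cube (2 * h) \<inter> {x::real^'n. x $ dir1 \<in> {0..h}}"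
  \<comment> \<open>The field has period \<open>2 * h\<close>, values in [-1, 1], and its
    \<open>dir1\<close> component rises from -1 at 0 to 1 at \<open>h\<close>, the largest jump
    allowed. Its divergence is nonnegative on the stripe, so \<open>nn_integral\<close> can be
    used.\<close>
  define \<phi> :: "real^'n \<Rightarrow> real^'n" where "\<phi> = (\<lambda>x. - cos (pi / h * x $ dir1) *\<^sub>R axis dir1 1)"
  define s where "s = (\<lambda>y. pi / h * sin (pi / h * y))"
  have der: "(\<phi> has_derivative (\<lambda>v. (s (x $ dir1) * v $ dir1) *\<^sub>R axis dir1 1)) (at x)" for x
    unfolding \<phi>_def s_def
    by (auto intro!: derivative_eq_intros bounded_linear_imp_has_derivative bounded_linear_vec_nth
        simp: mult_ac h[THEN less_imp_neq, symmetric])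
  then have fr: "frechet_derivative \<phi> (at x) = (\<lambda>v. (s (x $ dir1) * v $ dir1) *\<^sub>R axis dir1 1)" for x
    by (metis frechet_derivative_at)
  have "\<phi> (x + (2 * h) *\<^sub>R axis j 1) = \<phi> x" for x j
  proof (cases "j = dir1")
    case True
    have "pi / h * (x + (2 * h) *\<^sub>R axis j 1) $ dir1 = pi / h * x $ dir1 + 2 * pi"
      using h True by (simp add: field_simps)
    then show ?thesis
      unfolding \<phi>_def by (simp only: cos_periodic)
  qed (simp add: \<phi>_def axis_def)
  moreover have "\<bar>\<phi> x $ j\<bar> \<le> 1" for x j
    by (simp add: \<phi>_def axis_def abs_cos_le_one)
  moreover have "\<phi> differentiable at x" for x
    using der unfolding differentiable_def by blast
  moreover have "continuous_on UNIV (\<lambda>x. frechet_derivative \<phi> (at x) (axis j 1))" for j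
    unfolding fr s_def by (intro continuous_intros)
  ultimately have \<phi>: "\<phi> \<in> per_test_fields (2 * h)"
    unfolding per_test_fields_def by blast
  have "divergence \<phi> x = s (x $ dir1)" for x
  proof -
    have "divergence \<phi> x = (\<Sum>j\<in>(UNIV::'n set). if j = dir1 then s (x $ dir1) else 0)"
      unfolding divergence_def fr by (intro sum.cong) (auto simp: axis_def)
    then show ?thesis by simp
  qed
  then have "(LINT x:Eh h \<inter> cube (2 * h)|lborel. divergence \<phi> x)
      = (\<integral>x. indicator ?A x * s (x $ dir1) \<partial>lborel)"
    unfolding set_lebesgue_integral_def Eh_Int_cube[OF h] by simp
  also have "\<dots> = 2 * (2 * h) ^ (CARD('n) - 1)"
  proof -
    have s0: "0 \<le> s y" if "y \<in> {0..h}" for y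
      unfolding s_def using that h
      by (intro mult_nonneg_nonneg sin_ge_zero) (auto simp: field_simps)
    have [measurable]: "s \<in> borel_measurable borel"
      unfolding s_def by measurable
    have "AE x in lborel. 0 \<le> indicator ?A x * s (x $ dir1)"
      using s0 by (intro AE_I2) (simp add: indicator_def)
    then have "(\<integral>x. indicator ?A x * s (x $ dir1) \<partial>lborel)
        = enn2real (\<integral>\<^sup>+x. ennreal (indicator ?A x * s (x $ dir1)) \<partial>lborel)"
      by (intro integral_eq_nn_integral) (auto simp: cube_borel)
    also have "(\<integral>\<^sup>+x. ennreal (indicator ?A x * s (x $ dir1)) \<partial>lborel)
        = (\<integral>\<^sup>+(x::real^'n). indicator (cube (2 * h)) x * (\<lambda>y. ennreal (s y) * indicator {0..h} y) (x $ dir1) \<partial>lborel)"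
      by (intro nn_integral_cong) (auto simp: indicator_def)
    also have "\<dots> = ennreal ((2 * h) ^ (CARD('n) - 1))
        * (\<integral>\<^sup>+y. indicator {0..<2 * h} y * (ennreal (s y) * indicator {0..h} y) \<partial>lborel)"
      by (rule nn_integral_cube_coordinate) (use h in auto)
    also have "(\<integral>\<^sup>+y. indicator {0..<2 * h} y * (ennreal (s y) * indicator {0..h} y) \<partial>lborel)
        = (\<integral>\<^sup>+y. ennreal (s y) * indicator {0..h} y \<partial>lborel)"
      using h by (intro nn_integral_cong) (auto simp: indicator_def)
    also have "\<dots> = ennreal (- cos (pi / h * h) - - cos (pi / h * 0))"
      by (rule nn_integral_FTC_Icc)
         (use h s0 in \<open>auto simp: s_def intro!: derivative_eq_intros has_vector_derivative_at_within\<close>)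
    also have "ennreal ((2 * h) ^ (CARD('n) - 1)) * ennreal (- cos (pi / h * h) - - cos (pi / h * 0))
        = ennreal (2 * (2 * h) ^ (CARD('n) - 1))"
      using h by (subst ennreal_mult[symmetric]) (auto simp: mult.commute)
    finally show ?thesis
      using h by (simp add: zero_le_mult_iff)
  qed
  finally show "2 * (2 * h) ^ (CARD('n) - 1)
      \<in> (\<lambda>\<phi>. LINT x:Eh h \<inter> cube (2 * h)|lborel. divergence \<phi> x) ` (per_test_fields (2 * h) :: (real^'n \<Rightarrow> real^'n) set)"
    using \<phi> by (metis image_eqI)
next
  fix y assume "y \<in> (\<lambda>\<phi>. LINT x:Eh h \<inter> cube (2 * h)|lborel. divergence \<phi> x) ` (per_test_fields (2 * h) :: (real^'n \<Rightarrow> real^'n) set)"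
  then obtain \<phi> :: "real^'n \<Rightarrow> real^'n" where \<phi>: "\<phi> \<in> per_test_fields (2 * h)"
    and y: "y = (LINT x:Eh h \<inter> cube (2 * h)|lborel. divergence \<phi> x)" by blast
  have "is_interval {0..h}" by simp
  from divergence_stripe_bound[OF \<phi> _ this, of dir1] h
  show "y \<le> 2 * (2 * h) ^ (CARD('n) - 1)"
    unfolding y set_lebesgue_integral_def Eh_Int_cube[OF h] by simp
qed

section \<open>Laplace transforms\<close>

text \<open>The positive measure whose Laplace transform is \<open>exp (- m * r) / r ^ k\<close>: a
  shifted Gamma-type density, degenerating to a point mass at \<open>m\<close> when
  \<open>k = 0\<close>. It is applied with \<open>k = CARD('n) - 2\<close>.\<close>

definition laplace_measure :: "nat \<Rightarrow> real \<Rightarrow> real measure" where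
  "laplace_measure k m = (if k = 0 then return borel m
    else density lborel (\<lambda>\<alpha>. ennreal (indicator {m..} \<alpha> * ((\<alpha> - m) ^ (k - 1) / fact (k - 1)))))"

lemma sets_laplace_measure [simp, measurable_cong]: "sets (laplace_measure k m) = sets borel"
  by (simp add: laplace_measure_def)

lemma space_laplace_measure [simp]: "space (laplace_measure k m) = UNIV"
  by (simp add: laplace_measure_def)

lemma sigma_finite_laplace_measure: "sigma_finite_measure (laplace_measure k m)"
proof (cases "k = 0")
  case True
  interpret prob_space "return borel m" by (rule prob_space_return) simp
  show ?thesis
    using True by (simp add: laplace_measure_def sigma_finite_measure_axioms)
next
  case False
  then show ?thesis
    by (simp add: laplace_measure_def sigma_finite_measure.sigma_finite_iff_density_finite[OF sigma_finite_lborel])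
qed

lemma AE_laplace_measure: "AE \<alpha> in laplace_measure k m. m \<le> \<alpha>"
proof (cases "k = 0")
  case True
  then have "laplace_measure k m = return borel m"
    by (simp add: laplace_measure_def)
  then show ?thesis
    by (simp only:) (subst AE_return, auto)
next
  case False
  then have "laplace_measure k m = density lborel (\<lambda>\<alpha>. ennreal (indicator {m..} \<alpha> * ((\<alpha> - m) ^ (k - 1) / fact (k - 1))))"
    by (simp add: laplace_measure_def)
  then show ?thesis
    by (simp only:) (subst AE_density, auto simp: indicator_def)
qed

lemma nn_integral_laplace_measure_exp:
  assumes r: "r > 0"
  shows "(\<integral>\<^sup>+\<alpha>. ennreal (exp (- \<alpha> * r)) \<partial>laplace_measure k m) = ennreal (exp (- m * r) / r ^ k)"
proof (cases "k = 0")
  case True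
  then show ?thesis
    by (simp add: laplace_measure_def nn_integral_return)
next
  case False
  define l where "l = k - 1"
  have k: "k = Suc l" using False by (simp add: l_def)
  have "(\<integral>\<^sup>+\<alpha>. ennreal (exp (- \<alpha> * r)) \<partial>laplace_measure k m)
      = (\<integral>\<^sup>+\<alpha>. ennreal (indicator {m..} \<alpha> * ((\<alpha> - m) ^ l / fact l)) * ennreal (exp (- \<alpha> * r)) \<partial>lborel)"
    unfolding laplace_measure_def k by (simp add: nn_integral_density)
  also have "\<dots> = ennreal (1 / r) * (\<integral>\<^sup>+x. ennreal (indicator {m..} (m + 1 / r * x) * ((m + 1 / r * x - m) ^ l / fact l))
      * ennreal (exp (- (m + 1 / r * x) * r)) \<partial>lborel)"
    \<comment> \<open>The substitution \<alpha> = m + x/r reduces the integral to the one of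
      \<open>x ^ l * exp (- x)\<close> over the half-line, which is \<open>fact l\<close>.\<close>
    using r by (subst nn_integral_real_affine[where c="1/r" and t=m]) auto
  also have "(\<integral>\<^sup>+x. ennreal (indicator {m..} (m + 1 / r * x) * ((m + 1 / r * x - m) ^ l / fact l))
      * ennreal (exp (- (m + 1 / r * x) * r)) \<partial>lborel)
      = (\<integral>\<^sup>+x. ennreal (exp (- m * r) / r ^ l / fact l) * (ennreal (x ^ l * exp (- x)) * indicator {0..} x) \<partial>lborel)"
  proof (intro nn_integral_cong)
    fix x :: real
    show "ennreal (indicator {m..} (m + 1 / r * x) * ((m + 1 / r * x - m) ^ l / fact l))
        * ennreal (exp (- (m + 1 / r * x) * r))
      = ennreal (exp (- m * r) / r ^ l / fact l) * (ennreal (x ^ l * exp (- x)) * indicator {0..} x)"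
    proof (cases "x \<ge> 0")
      case True
      have "exp (- (m + 1 / r * x) * r) = exp (- m * r) * exp (- x)"
        using r by (simp add: exp_add[symmetric] field_simps)
      then show ?thesis
        using True r by (simp add: ennreal_mult[symmetric] power_divide field_simps)
    next
      case False
      then show ?thesis
        using r by (simp add: field_simps)
    qed
  qed
  also have "\<dots> = ennreal (exp (- m * r) / r ^ l / fact l) * ennreal (fact l)"
    by (subst nn_integral_cmult) (auto simp: nn_intergal_power_times_exp_Ici)
  also have "ennreal (1 / r) * \<dots> = ennreal (exp (- m * r) / r ^ k)"
    using r by (simp add: ennreal_mult[symmetric] k field_simps)
  finally show ?thesis .
qed

text \<open>With \<open>d = k + 2\<close>, this is up to the factor \<open>2 ^ d\<close> the
  integral of the kernel over the whole space. The density grows at most like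
  \<open>\<alpha> ^ (k - 1)\<close>, which leaves the decay \<open>1 / \<alpha> ^ 3\<close>.\<close>

lemma nn_integral_laplace_measure_finite:
  assumes m: "m > 0"
  shows "(\<integral>\<^sup>+\<alpha>. ennreal (1 / \<alpha> ^ (k + 2)) \<partial>laplace_measure k m) < \<infinity>"
proof (cases "k = 0")
  case True
  then show ?thesis
    by (simp add: laplace_measure_def nn_integral_return)
next
  case False
  define l where "l = k - 1"
  have k: "k = Suc l" using False by (simp add: l_def)
  have "(\<integral>\<^sup>+\<alpha>. ennreal (1 / \<alpha> ^ (k + 2)) \<partial>laplace_measure k m)
      = (\<integral>\<^sup>+\<alpha>. ennreal (indicator {m..} \<alpha> * ((\<alpha> - m) ^ l / fact l)) * ennreal (1 / \<alpha> ^ (k + 2)) \<partial>lborel)"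
    unfolding laplace_measure_def k by (simp add: nn_integral_density)
  also have "\<dots> \<le> (\<integral>\<^sup>+\<alpha>. ennreal (1 / \<alpha> ^ 3) * indicator {m..} \<alpha> \<partial>lborel)"
  proof (intro nn_integral_mono)
    fix \<alpha> :: real
    show "ennreal (indicator {m..} \<alpha> * ((\<alpha> - m) ^ l / fact l)) * ennreal (1 / \<alpha> ^ (k + 2))
        \<le> ennreal (1 / \<alpha> ^ 3) * indicator {m..} \<alpha>"
    proof (cases "m \<le> \<alpha>")
      case True
      have "(\<alpha> - m) ^ l / fact l \<le> \<alpha> ^ l / 1"
        using True m by (intro frac_le power_mono) (auto simp: fact_ge_1)
      then have "(\<alpha> - m) ^ l / fact l * (1 / \<alpha> ^ (k + 2)) \<le> \<alpha> ^ l * (1 / \<alpha> ^ (k + 2))"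
        using True m by (intro mult_right_mono) auto
      also have "\<dots> = 1 / \<alpha> ^ 3"
        using True m by (simp add: k field_simps power_add[symmetric] eval_nat_numeral)
      finally show ?thesis
        using True m by (simp add: ennreal_mult[symmetric] del: times_divide_eq_right)
    qed simp
  qed
  also have "\<dots> = ennreal (0 - (- 1 / (2 * m ^ 2)))"
  proof (rule nn_integral_FTC_atLeast)
    fix x assume "m \<le> x"
    with m show "((\<lambda>x. - 1 / (2 * x ^ 2)) has_real_derivative 1 / x ^ 3) (at x)"
      by (auto intro!: derivative_eq_intros simp: field_simps eval_nat_numeral)
    show "0 \<le> 1 / x ^ 3" using \<open>m \<le> x\<close> m by simp
  next
    show "((\<lambda>x::real. - 1 / (2 * x ^ 2)) \<longlongrightarrow> 0) at_top"
      by real_asymp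
  qed auto
  finally show ?thesis
    by (rule order.strict_trans1) simp
qed

section \<open>Exponential integrals on the line\<close>

lemma nn_integral_even_split:
  fixes f :: "real \<Rightarrow> ennreal"
  assumes [measurable]: "f \<in> borel_measurable borel"
  shows "(\<integral>\<^sup>+t. f t \<partial>lborel) = (\<integral>\<^sup>+t. f t * indicator {0..} t \<partial>lborel) + (\<integral>\<^sup>+t. f (- t) * indicator {0..} t \<partial>lborel)"
proof -
  have "(\<integral>\<^sup>+t. f t \<partial>lborel) = (\<integral>\<^sup>+t. f t * indicator {0..} t + f t * indicator {..<0} t \<partial>lborel)"
    by (intro nn_integral_cong) (auto simp: indicator_def)
  also have "\<dots> = (\<integral>\<^sup>+t. f t * indicator {0..} t \<partial>lborel) + (\<integral>\<^sup>+t. f t * indicator {..<0} t \<partial>lborel)"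
    by (rule nn_integral_add) auto
  also have "(\<integral>\<^sup>+t. f t * indicator {..<0} t \<partial>lborel) = (\<integral>\<^sup>+t. f (- t) * indicator {..<0} (- t) \<partial>lborel)"
    by (subst nn_integral_real_affine[where c="-1" and t=0]) auto
  also have "\<dots> = (\<integral>\<^sup>+t. f (- t) * indicator {0..} t \<partial>lborel)"
  proof (rule nn_integral_cong_AE)
    show "AE t in lborel. f (- t) * indicator {..<0} (- t) = f (- t) * indicator {0..} t"
      using AE_lborel_singleton[of "0::real"] by eventually_elim (auto simp: indicator_def)
  qed
  finally show ?thesis .
qed

lemma nn_integral_exp_Ici:
  assumes "\<alpha> > 0"
  shows "(\<integral>\<^sup>+t. ennreal (exp (- \<alpha> * t)) * indicator {0..} t \<partial>lborel) = ennreal (1 / \<alpha>)"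
proof -
  have "(\<integral>\<^sup>+t. ennreal (exp (- \<alpha> * t)) * indicator {0..} t \<partial>lborel) = ennreal (0 - (- exp (- \<alpha> * 0) / \<alpha>))"
  proof (rule nn_integral_FTC_atLeast)
    show "((\<lambda>t. - exp (- \<alpha> * t) / \<alpha>) \<longlongrightarrow> 0) at_top"
      using assms by real_asymp
  qed (use assms in \<open>auto intro!: derivative_eq_intros\<close>)
  then show ?thesis by simp
qed

lemma nn_integral_exp_abs:
  assumes "\<alpha> > 0"
  shows "(\<integral>\<^sup>+t. ennreal (exp (- \<alpha> * \<bar>t\<bar>)) \<partial>lborel) = ennreal (2 / \<alpha>)"
proof -
  have "(\<integral>\<^sup>+t. ennreal (exp (- \<alpha> * \<bar>t\<bar>)) \<partial>lborel)
      = (\<integral>\<^sup>+t. ennreal (exp (- \<alpha> * t)) * indicator {0..} t \<partial>lborel) + (\<integral>\<^sup>+t. ennreal (exp (- \<alpha> * t)) * indicator {0..} t \<partial>lborel)"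
    by (subst nn_integral_even_split) (auto intro!: arg_cong2[where f="(+)"] nn_integral_cong simp: indicator_def)
  also have "\<dots> = ennreal (2 / \<alpha>)"
    unfolding nn_integral_exp_Ici[OF assms] using assms by (subst ennreal_plus[symmetric]) auto
  finally show ?thesis .
qed

lemma nn_integral_abs_exp_abs:
  assumes \<alpha>: "\<alpha> > 0" and R: "R \<ge> 0"
  shows "(\<integral>\<^sup>+t. ennreal (indicator {-R..R} t * \<bar>t\<bar> * exp (- \<alpha> * \<bar>t\<bar>)) \<partial>lborel)
    = ennreal (2 / \<alpha>\<^sup>2 * (1 - exp (- \<alpha> * R) * (1 + \<alpha> * R)))"
proof -
  let ?I = "\<integral>\<^sup>+t. ennreal (t * exp (- \<alpha> * t)) * indicator {0..R} t \<partial>lborel"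
  define F where "F = (\<lambda>t. - (t / \<alpha> + 1 / \<alpha>\<^sup>2) * exp (- \<alpha> * t))"
  have I: "?I = ennreal (F R - F 0)"
  proof (rule nn_integral_FTC_Icc)
    show "(F has_real_derivative x * exp (- \<alpha> * x)) (at x)" for x
      unfolding F_def using \<alpha> by (auto intro!: derivative_eq_intros simp: field_simps power2_eq_square)
  qed (use R in auto)
  have F: "F R - F 0 = 1 / \<alpha>\<^sup>2 * (1 - exp (- \<alpha> * R) * (1 + \<alpha> * R))"
    using \<alpha> by (simp add: F_def field_simps power2_eq_square)
  have "F 0 \<le> F R"
  proof (rule DERIV_nonneg_imp_nondecreasing[OF R])
    fix x assume "0 \<le> x" "x \<le> R"
    then show "\<exists>y. (F has_real_derivative y) (at x) \<and> 0 \<le> y"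
      unfolding F_def using \<alpha>
      by (intro exI[of _ "x * exp (- \<alpha> * x)"]) (auto intro!: derivative_eq_intros simp: field_simps power2_eq_square)
  qed
  have "(\<integral>\<^sup>+t. ennreal (indicator {-R..R} t * \<bar>t\<bar> * exp (- \<alpha> * \<bar>t\<bar>)) \<partial>lborel) = ?I + ?I"
    by (subst nn_integral_even_split) (auto intro!: arg_cong2[where f="(+)"] nn_integral_cong simp: indicator_def)
  also have "\<dots> = ennreal (2 * (F R - F 0))"
    unfolding I using \<open>F 0 \<le> F R\<close> by (subst ennreal_plus[symmetric]) auto
  finally show ?thesis
    unfolding F by simp
qed

section \<open>The one-dimensional stripe pattern\<close>

definition stripes :: "real \<Rightarrow> real set" where
  "stripes h = {s. \<exists>j::int. 2 * of_int j * h \<le> s \<and> s \<le> (2 * of_int j + 1) * h}"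

lemma stripes_borel [measurable]: "stripes h \<in> sets borel"
proof -
  have "stripes h = (\<Union>j::int. {2 * of_int j * h .. (2 * of_int j + 1) * h})"
    by (auto simp: stripes_def)
  then show ?thesis by simp
qed

lemma stripes_iff_even:
  assumes h: "h > 0" and k: "of_int k * h < s" "s < of_int (k + 1) * h"
  shows "s \<in> stripes h \<longleftrightarrow> even k"
proof
  assume "s \<in> stripes h"
  then obtain j :: int where j: "2 * of_int j * h \<le> s" "s \<le> (2 * of_int j + 1) * h"
    unfolding stripes_def by blast
  have "of_int (2 * j) * h < of_int (k + 1) * h" "of_int k * h < of_int (2 * j + 1) * h"
    using j k by auto
  then have "2 * j < k + 1" "k < 2 * j + 1"
    using h by (simp_all only: mult_less_cancel_right_pos of_int_less_iff)
  then have "k = 2 * j" by linarith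
  then show "even k" by simp
next
  assume "even k"
  then obtain j where "k = 2 * j" by blast
  with k show "s \<in> stripes h"
    unfolding stripes_def by (auto intro!: exI[of _ j])
qed

text \<open>Translation by one width exchanges stripes and gaps. Multiples of \<open>h\<close> are
  exceptions because the stripes are closed: such a point and its translate both lie in
  \<open>stripes h\<close>.\<close>

lemma stripes_shift:
  assumes h: "h > 0" and s: "\<And>k::int. s \<noteq> of_int k * h"
  shows "s + h \<in> stripes h \<longleftrightarrow> s \<notin> stripes h"
proof -
  define k where "k = \<lfloor>s / h\<rfloor>"
  have "of_int k \<le> s / h" "s / h < of_int (k + 1)"
    unfolding k_def by linarith+
  then have "of_int k * h \<le> s" "s < of_int (k + 1) * h"
    using h by (simp_all add: field_simps)
  then have k: "of_int k * h < s" "s < of_int (k + 1) * h"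
    using s[of k] by auto
  then have k': "of_int (k + 1) * h < s + h" "s + h < of_int (k + 1 + 1) * h"
    by (auto simp: algebra_simps)
  show ?thesis
    using stripes_iff_even[OF h k] stripes_iff_even[OF h k'] by simp
qed

text \<open>Symmetry about \<open>h / 2\<close>. It turns what is seen to the left of
  \<open>x\<close> into what is seen to the right of \<open>h - x\<close>.\<close>

lemma stripes_reflect: "h - s \<in> stripes h \<longleftrightarrow> s \<in> stripes h"
proof -
  have "h - s \<in> stripes h" if s: "s \<in> stripes h" for s
  proof -
    obtain j :: int where j: "2 * of_int j * h \<le> s" "s \<le> (2 * of_int j + 1) * h"
      using s unfolding stripes_def by blast
    then show ?thesis
      unfolding stripes_def by (auto intro!: exI[of _ "- j"] simp: algebra_simps)
  qed
  from this[of s] this[of "h - s"] show ?thesis by auto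
qed

lemma stripes_base: "0 \<le> s \<Longrightarrow> s \<le> h \<Longrightarrow> s \<in> stripes h"
  unfolding stripes_def by (auto intro!: exI[of _ 0])

lemma AE_stripes_shift:
  assumes h: "h > 0"
  shows "AE t in lborel. x + t + h \<in> stripes h \<longleftrightarrow> x + t \<notin> stripes h"
proof -
  have "AE t in lborel. \<forall>k::int. t \<noteq> of_int k * h - x"
    unfolding AE_all_countable by (auto intro: AE_lborel_singleton)
  then show ?thesis
  proof eventually_elim
    case (elim t)
    then have "x + t \<noteq> of_int k * h" for k :: int
      by (metis add_diff_cancel_left')
    then show ?case by (rule stripes_shift[OF h])
  qed
qed

section \<open>One-sided Laplace transforms of the pattern\<close>

definition gap_transform :: "real \<Rightarrow> real \<Rightarrow> real \<Rightarrow> ennreal" where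
  "gap_transform h \<alpha> x = (\<integral>\<^sup>+t. ennreal (exp (- \<alpha> * t)) * indicator {0..} t * indicator (- stripes h) (x + t) \<partial>lborel)"

definition stripe_transform :: "real \<Rightarrow> real \<Rightarrow> real \<Rightarrow> ennreal" where
  "stripe_transform h \<alpha> x = (\<integral>\<^sup>+t. ennreal (exp (- \<alpha> * t)) * indicator {0..} t * indicator (stripes h) (x + t) \<partial>lborel)"

lemma stripe_transform_eq_gap:
  assumes h: "h > 0"
  shows "stripe_transform h \<alpha> x = gap_transform h \<alpha> (x + h)"
    and "stripe_transform h \<alpha> x = gap_transform h \<alpha> (x - h)"
  unfolding stripe_transform_def gap_transform_def
proof -
  show "(\<integral>\<^sup>+t. ennreal (exp (- \<alpha> * t)) * indicator {0..} t * indicator (stripes h) (x + t) \<partial>lborel)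
      = (\<integral>\<^sup>+t. ennreal (exp (- \<alpha> * t)) * indicator {0..} t * indicator (- stripes h) (x + h + t) \<partial>lborel)"
  proof (rule nn_integral_cong_AE)
    show "AE t in lborel. ennreal (exp (- \<alpha> * t)) * indicator {0..} t * indicator (stripes h) (x + t)
        = ennreal (exp (- \<alpha> * t)) * indicator {0..} t * indicator (- stripes h) (x + h + t)"
      using AE_stripes_shift[OF h, of x]
    proof eventually_elim
      case (elim t)
      have "x + h + t = x + t + h" by simp
      with elim have "x + h + t \<in> stripes h \<longleftrightarrow> x + t \<notin> stripes h" by (simp only:)
      then show ?case by (simp add: indicator_def)
    qed
  qed
  show "(\<integral>\<^sup>+t. ennreal (exp (- \<alpha> * t)) * indicator {0..} t * indicator (stripes h) (x + t) \<partial>lborel)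
      = (\<integral>\<^sup>+t. ennreal (exp (- \<alpha> * t)) * indicator {0..} t * indicator (- stripes h) (x - h + t) \<partial>lborel)"
  proof (rule nn_integral_cong_AE)
    show "AE t in lborel. ennreal (exp (- \<alpha> * t)) * indicator {0..} t * indicator (stripes h) (x + t)
        = ennreal (exp (- \<alpha> * t)) * indicator {0..} t * indicator (- stripes h) (x - h + t)"
      using AE_stripes_shift[OF h, of "x - h"]
    proof eventually_elim
      case (elim t)
      have "x + t = x - h + t + h" by simp
      with elim have "x + t \<in> stripes h \<longleftrightarrow> x - h + t \<notin> stripes h" by (simp only:)
      then show ?case by (simp add: indicator_def)
    qed
  qed
qed

text \<open>From a point of \<open>[0, h]\<close>, nothing to the right before \<open>h\<close>
  belongs to a gap, so the integration effectively starts at \<open>h\<close> and the distance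
  \<open>h - x\<close> factors out of the exponential.\<close>

lemma gap_transform_shift:
  assumes "0 \<le> x" "x \<le> h"
  shows "gap_transform h \<alpha> x = ennreal (exp (- \<alpha> * (h - x))) * gap_transform h \<alpha> h"
proof -
  have "gap_transform h \<alpha> x = (\<integral>\<^sup>+t. ennreal (exp (- \<alpha> * (h - x + t))) * indicator {0..} (h - x + t)
      * indicator (- stripes h) (x + (h - x + t)) \<partial>lborel)"
    unfolding gap_transform_def
    by (subst nn_integral_real_affine[where c=1 and t="h - x"]) auto
  also have "\<dots> = (\<integral>\<^sup>+t. ennreal (exp (- \<alpha> * (h - x))) * (ennreal (exp (- \<alpha> * t)) * indicator {0..} t
      * indicator (- stripes h) (h + t)) \<partial>lborel)"
  proof (intro nn_integral_cong)
    fix t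
    have e: "exp (- \<alpha> * (h - x + t)) = exp (- \<alpha> * (h - x)) * exp (- \<alpha> * t)"
      by (simp add: exp_add[symmetric] algebra_simps)
    have "h + t \<in> stripes h" if "t < 0" "0 \<le> h - x + t"
      using that assms by (intro stripes_base) auto
    then show "ennreal (exp (- \<alpha> * (h - x + t))) * indicator {0..} (h - x + t)
      * indicator (- stripes h) (x + (h - x + t))
      = ennreal (exp (- \<alpha> * (h - x))) * (ennreal (exp (- \<alpha> * t)) * indicator {0..} t
      * indicator (- stripes h) (h + t))"
      using assms unfolding e by (auto simp: indicator_def ennreal_mult)
  qed
  also have "\<dots> = ennreal (exp (- \<alpha> * (h - x))) * gap_transform h \<alpha> h"
    unfolding gap_transform_def by (rule nn_integral_cmult) auto
  finally show ?thesis .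
qed

lemma gap_transform_plus_stripe_transform:
  assumes "\<alpha> > 0"
  shows "stripe_transform h \<alpha> x + gap_transform h \<alpha> x = ennreal (1 / \<alpha>)"
proof -
  have "stripe_transform h \<alpha> x + gap_transform h \<alpha> x
      = (\<integral>\<^sup>+t. ennreal (exp (- \<alpha> * t)) * indicator {0..} t * indicator (stripes h) (x + t)
        + ennreal (exp (- \<alpha> * t)) * indicator {0..} t * indicator (- stripes h) (x + t) \<partial>lborel)"
    unfolding stripe_transform_def gap_transform_def by (rule nn_integral_add[symmetric]) auto
  also have "\<dots> = (\<integral>\<^sup>+t. ennreal (exp (- \<alpha> * t)) * indicator {0..} t \<partial>lborel)"
    by (intro nn_integral_cong) (auto simp: indicator_def)
  finally show ?thesis
    using nn_integral_exp_Ici[OF assms] by simp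
qed

text \<open>Writing \<open>Z\<close> for the gap transform, the three lemmas above give
  \<open>Z(0) = exp(-\<alpha>h) Z(h)\<close> and \<open>Z(h) + Z(0) = 1/\<alpha>\<close>; this replaces summing a geometric series over the gaps.\<close>

lemma gap_transform_eq:
  assumes \<alpha>: "\<alpha> > 0" and h: "h > 0" and x: "0 \<le> x" "x \<le> h"
  shows "gap_transform h \<alpha> x = ennreal (exp (- \<alpha> * (h - x)) / (\<alpha> * (1 + exp (- \<alpha> * h))))"
proof -
  let ?z = "gap_transform h \<alpha> h"
  have sum: "?z + ennreal (exp (- \<alpha> * h)) * ?z = ennreal (1 / \<alpha>)"
    using gap_transform_plus_stripe_transform[OF \<alpha>, of h 0] stripe_transform_eq_gap(1)[OF h, of \<alpha> 0]
      gap_transform_shift[of 0 h \<alpha>] h by simp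
  \<comment> \<open>Finiteness comes first, so that the linear equation in \<open>ennreal\<close>
    can be solved in the reals.\<close>
  then have "?z \<le> ennreal (1 / \<alpha>)"
    by (metis le_add_same_cancel1 zero_le add.commute add_increasing order_refl)
  then have "?z < top"
    by (rule order.strict_trans1) simp
  then obtain z where z: "?z = ennreal z" "z \<ge> 0"
    by (cases ?z) auto
  have "ennreal (z + exp (- \<alpha> * h) * z) = ennreal (1 / \<alpha>)"
    using sum z by (simp add: ennreal_mult[symmetric] ennreal_plus[symmetric] del: ennreal_plus)
  then have "z + exp (- \<alpha> * h) * z = 1 / \<alpha>"
    using z \<alpha> by (subst (asm) ennreal_inj) auto
  then have "z * (1 + exp (- \<alpha> * h)) = 1 / \<alpha>"
    by (simp add: algebra_simps)
  then have "z = 1 / (\<alpha> * (1 + exp (- \<alpha> * h)))"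
    using \<alpha> by (simp add: field_simps add_pos_pos less_imp_neq[symmetric])
  then show ?thesis
    using gap_transform_shift[OF x, of \<alpha>] z by (simp add: ennreal_mult[symmetric])
qed

definition stripe_interaction :: "real \<Rightarrow> real \<Rightarrow> real \<Rightarrow> ennreal" where
  "stripe_interaction h \<alpha> x = (\<integral>\<^sup>+t. ennreal (\<bar>indicator (stripes h) (x + t) - indicator (stripes h) x\<bar> * exp (- \<alpha> * \<bar>t\<bar>)) \<partial>lborel)"

text \<open>The difference of indicators selects points of the opposite phase. The right half-line
  gives the transform at \<open>x\<close>, the left half-line by reflection the one at
  \<open>h - x\<close>.\<close>

lemma stripe_interaction_split:
  "stripe_interaction h \<alpha> x
    = (if x \<in> stripes h then gap_transform h \<alpha> x + gap_transform h \<alpha> (h - x)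
       else stripe_transform h \<alpha> x + stripe_transform h \<alpha> (h - x))"
proof -
  have r: "h - x + t \<in> stripes h \<longleftrightarrow> x - t \<in> stripes h" for t
    using stripes_reflect[of h "x - t"] by (simp add: algebra_simps)
  show ?thesis
    unfolding stripe_interaction_def gap_transform_def stripe_transform_def
    by (subst nn_integral_even_split)
       (auto intro!: arg_cong2[where f="(+)"] nn_integral_cong simp: indicator_def r)
qed

text \<open>On the stripe the interaction is the sum \<open>w\<close> of two exponentials, and on
  the gap it is the same profile translated by \<open>h\<close>; so the result is twice the integral
  of \<open>w\<close>. The hyperbolic tangent is the quotient
  \<open>(1 - exp (- \<alpha> * h)) / (1 + exp (- \<alpha> * h))\<close>.\<close>

lemma nn_integral_stripe_interaction:
  assumes \<alpha>: "\<alpha> > 0" and h: "h > 0"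
  shows "(\<integral>\<^sup>+x. indicator {0..<2 * h} x * stripe_interaction h \<alpha> x \<partial>lborel)
    = ennreal (4 / \<alpha>\<^sup>2 * tanh (\<alpha> * h / 2))"
proof -
  define w where "w = (\<lambda>x. (exp (- \<alpha> * (h - x)) + exp (- \<alpha> * x)) / (\<alpha> * (1 + exp (- \<alpha> * h))))"
  have w0: "w x \<ge> 0" for x
    using \<alpha> by (simp add: w_def add_nonneg_nonneg)
  have gap: "gap_transform h \<alpha> x + gap_transform h \<alpha> (h - x) = ennreal (w x)" if "0 \<le> x" "x \<le> h" for x
    using that \<alpha> by (simp add: gap_transform_eq[OF \<alpha> h] w_def ennreal_plus[symmetric] add_divide_distrib
        add_pos_pos zero_le_mult_iff less_imp_le del: ennreal_plus)
  have left: "stripe_interaction h \<alpha> x = ennreal (w x)" if "0 \<le> x" "x \<le> h" for x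
    using that stripes_base[of x h] by (simp add: stripe_interaction_split gap)
  have right: "stripe_interaction h \<alpha> x = ennreal (w (x - h))" if "h < x" "x < 2 * h" for x
  proof -
    \<comment> \<open>In the gap both stripe transforms become gap transforms, at
      \<open>x - h\<close> and at \<open>(h - x) + h = h - (x - h)\<close>; this is why shifts in
      both directions are provided.\<close>
    have "x \<notin> stripes h"
      using stripes_iff_even[OF h, of 1 x] that by simp
    then have "stripe_interaction h \<alpha> x = gap_transform h \<alpha> (x - h) + gap_transform h \<alpha> (h - (x - h))"
      unfolding stripe_interaction_split
      by (simp add: stripe_transform_eq_gap(2)[OF h, of _ x] stripe_transform_eq_gap(1)[OF h, of _ "h - x"] algebra_simps)
    then show ?thesis
      using gap[of "x - h"] that by simp
  qed
  define c where "c = 1 / (\<alpha>\<^sup>2 * (1 + exp (- \<alpha> * h)))"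
  define F where "F = (\<lambda>x. (exp (- \<alpha> * (h - x)) - exp (- \<alpha> * x)) * c)"
  have pos: "1 + exp (- \<alpha> * h) > 0"
    by (simp add: add_pos_pos)
  have dF: "(F has_real_derivative w x) (at x)" for x
  proof -
    have "(F has_real_derivative (exp (- \<alpha> * (h - x)) + exp (- \<alpha> * x)) * (\<alpha> * c)) (at x)"
      unfolding F_def by (auto intro!: derivative_eq_intros simp: algebra_simps)
    moreover have "\<alpha> * c = 1 / (\<alpha> * (1 + exp (- \<alpha> * h)))"
      using \<alpha> by (simp add: c_def power2_eq_square)
    ultimately show ?thesis
      by (simp add: w_def)
  qed
  have I1: "(\<integral>\<^sup>+x. ennreal (w x) * indicator {0..h} x \<partial>lborel) = ennreal (F h - F 0)"
    by (rule nn_integral_FTC_Icc) (use dF w0 h in \<open>auto simp: w_def\<close>)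
  have "AE x in lborel. x \<noteq> h \<and> x \<noteq> 2 * h"
    using AE_lborel_singleton[of h] AE_lborel_singleton[of "2 * h"] by auto
  then have "AE x in lborel. indicator {0..<2 * h} x * stripe_interaction h \<alpha> x
      = ennreal (w x) * indicator {0..h} x + ennreal (w (x - h)) * indicator {0..h} (x - h)"
  proof eventually_elim
    case (elim x)
    consider "x < 0" | "0 \<le> x" "x < h" | "h < x" "x < 2 * h" | "2 * h < x"
      using elim by linarith
    then show ?case
      using h by cases (auto simp: left right)
  qed
  then have "(\<integral>\<^sup>+x. indicator {0..<2 * h} x * stripe_interaction h \<alpha> x \<partial>lborel)
      = (\<integral>\<^sup>+x. ennreal (w x) * indicator {0..h} x + ennreal (w (x - h)) * indicator {0..h} (x - h) \<partial>lborel)"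
    by (rule nn_integral_cong_AE)
  also have "\<dots> = (\<integral>\<^sup>+x. ennreal (w x) * indicator {0..h} x \<partial>lborel)
      + (\<integral>\<^sup>+x. ennreal (w (x - h)) * indicator {0..h} (x - h) \<partial>lborel)"
    unfolding w_def by (rule nn_integral_add) auto
  also have "(\<integral>\<^sup>+x. ennreal (w (x - h)) * indicator {0..h} (x - h) \<partial>lborel)
      = (\<integral>\<^sup>+x. ennreal (w x) * indicator {0..h} x \<partial>lborel)"
    unfolding w_def by (subst nn_integral_real_affine[where c=1 and t="-h"]) auto
  also have "F h - F 0 = 2 / \<alpha>\<^sup>2 * tanh (\<alpha> * h / 2)"
  proof -
    have "F h - F 0 = 2 * (1 - exp (- \<alpha> * h)) * c"
      by (simp add: F_def algebra_simps)
    moreover have "tanh (\<alpha> * h / 2) = (1 - exp (- \<alpha> * h)) / (1 + exp (- \<alpha> * h))"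
      by (simp add: tanh_real_altdef)
    ultimately show ?thesis
      by (simp add: c_def)
  qed
  then have "(\<integral>\<^sup>+x. ennreal (w x) * indicator {0..h} x \<partial>lborel) = ennreal (2 / \<alpha>\<^sup>2 * tanh (\<alpha> * h / 2))"
    using I1 by simp
  finally show ?thesis
    using \<alpha> h by (simp add: ennreal_plus[symmetric] del: ennreal_plus)
qed

section \<open>The interaction kernel\<close>

text \<open>Common form of both kernels: \<open>K1\<close> is \<open>kern 1\<close>, and
  \<open>Kbar\<close> is a constant multiple of \<open>kern M\<close>.\<close>

definition kern :: "real \<Rightarrow> real^'n::finite \<Rightarrow> real" where
  "kern m \<zeta> = exp (- m * norm1 \<zeta>) / norm1 \<zeta> ^ (CARD('n) - 2)"

lemma borel_measurable_vec_nth_comp [measurable (raw)]: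
  fixes f :: "'a \<Rightarrow> real^'n::finite"
  assumes "f \<in> borel_measurable M"
  shows "(\<lambda>x. f x $ i) \<in> borel_measurable M"
  by (rule measurable_compose[OF assms]) (intro borel_measurable_continuous_onI continuous_intros)

lemma borel_measurable_tanh [measurable]: "(tanh :: real \<Rightarrow> real) \<in> borel_measurable borel"
  by (intro borel_measurable_continuous_onI continuous_intros) simp

lemma norm1_borel [measurable]: "norm1 \<in> borel_measurable borel"
  unfolding norm1_def[abs_def] by measurable

lemma kern_borel [measurable]: "kern m \<in> borel_measurable borel"
  unfolding kern_def[abs_def] by measurable

lemma norm1_nonneg: "0 \<le> norm1 x"
  by (simp add: norm1_def sum_nonneg)

lemma norm1_pos: "x \<noteq> 0 \<Longrightarrow> 0 < norm1 x"
  unfolding norm1_def by (auto simp: vec_eq_iff intro!: sum_pos2)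

lemma kern_nonneg: "0 \<le> kern m x"
  by (simp add: kern_def norm1_nonneg)

lemma exp_norm1: "exp (- \<alpha> * norm1 x) = (\<Prod>j\<in>UNIV. exp (- \<alpha> * \<bar>x $ j\<bar>))"
  by (simp add: norm1_def exp_sum sum_distrib_left sum_negf[symmetric])

text \<open>The origin is excluded: for \<open>d > 2\<close> division by zero makes
  \<open>kern\<close> vanish there, while the Laplace integral diverges.\<close>

lemma AE_kern_eq_laplace:
  "AE \<zeta> in (lborel :: (real^'n::finite) measure).
    ennreal (kern m \<zeta>) = (\<integral>\<^sup>+\<alpha>. ennreal (exp (- \<alpha> * norm1 \<zeta>)) \<partial>laplace_measure (CARD('n) - 2) m)"
  using AE_lborel_singleton[of 0]
proof eventually_elim
  case (elim \<zeta>)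
  show ?case
    unfolding kern_def nn_integral_laplace_measure_exp[OF norm1_pos[OF elim]] by (rule refl)
qed

lemma nn_integral_exp_norm1_coordinate:
  fixes i :: "'n::finite"
  assumes [measurable]: "f \<in> borel_measurable borel" and \<alpha>: "\<alpha> > 0" and f0: "\<And>t. 0 \<le> f t"
  shows "(\<integral>\<^sup>+(\<zeta>::real^'n). ennreal (f (\<zeta> $ i) * exp (- \<alpha> * norm1 \<zeta>)) \<partial>lborel)
    = (\<integral>\<^sup>+t. ennreal (f t * exp (- \<alpha> * \<bar>t\<bar>)) \<partial>lborel) * ennreal ((2 / \<alpha>) ^ (CARD('n) - 1))"
proof -
  have "ennreal (f (\<zeta> $ i) * exp (- \<alpha> * norm1 \<zeta>))
      = ennreal (f (\<zeta> $ i) * exp (- \<alpha> * \<bar>\<zeta> $ i\<bar>)) * (\<Prod>j\<in>UNIV-{i}. ennreal (exp (- \<alpha> * \<bar>\<zeta> $ j\<bar>)))"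
    for \<zeta> :: "real^'n"
    unfolding exp_norm1 by (subst prod.remove[of UNIV i]) (auto simp: prod_ennreal f0 prod_nonneg ennreal_mult[symmetric])
  then have "(\<integral>\<^sup>+(\<zeta>::real^'n). ennreal (f (\<zeta> $ i) * exp (- \<alpha> * norm1 \<zeta>)) \<partial>lborel)
      = (\<integral>\<^sup>+(\<zeta>::real^'n). (\<lambda>t. ennreal (f t * exp (- \<alpha> * \<bar>t\<bar>))) (\<zeta> $ i)
        * (\<Prod>j\<in>UNIV-{i}. (\<lambda>t. ennreal (exp (- \<alpha> * \<bar>t\<bar>))) (\<zeta> $ j)) \<partial>lborel)"
    by simp
  also have "\<dots> = (\<integral>\<^sup>+t. ennreal (f t * exp (- \<alpha> * \<bar>t\<bar>)) \<partial>lborel)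
      * (\<integral>\<^sup>+t. ennreal (exp (- \<alpha> * \<bar>t\<bar>)) \<partial>lborel) ^ (CARD('n) - 1)"
    by (rule nn_integral_vec_prod_single) auto
  finally show ?thesis
    unfolding nn_integral_exp_abs[OF \<alpha>] using \<alpha> by (simp add: ennreal_power)
qed

lemma AE_laplace_measure_pos: "m > 0 \<Longrightarrow> AE \<alpha> in laplace_measure k m. 0 < \<alpha>"
  using AE_laplace_measure[of m k] by eventually_elim simp

text \<open>Tonelli: for fixed \<alpha> the exponential is a product over coordinates, and each
  direction other than \<open>i\<close> contributes \<open>2 / \<alpha>\<close>. Every kernel
  integral below is an instance for some profile \<open>f\<close>.\<close>

lemma nn_integral_kern_coordinate:
  fixes i :: "'n::finite"
  assumes [measurable]: "f \<in> borel_measurable borel" and m: "m > 0" and f0: "\<And>t. 0 \<le> f t"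
  shows "(\<integral>\<^sup>+(\<zeta>::real^'n). ennreal (f (\<zeta> $ i) * kern m \<zeta>) \<partial>lborel)
    = (\<integral>\<^sup>+\<alpha>. (\<integral>\<^sup>+t. ennreal (f t * exp (- \<alpha> * \<bar>t\<bar>)) \<partial>lborel) * ennreal ((2 / \<alpha>) ^ (CARD('n) - 1))
        \<partial>laplace_measure (CARD('n) - 2) m)"
proof -
  let ?\<mu> = "laplace_measure (CARD('n) - 2) m"
  interpret \<mu>: sigma_finite_measure ?\<mu> by (rule sigma_finite_laplace_measure)
  interpret pair_sigma_finite "lborel :: (real^'n) measure" ?\<mu> ..
  have "(\<integral>\<^sup>+(\<zeta>::real^'n). ennreal (f (\<zeta> $ i) * kern m \<zeta>) \<partial>lborel)
      = (\<integral>\<^sup>+(\<zeta>::real^'n). (\<integral>\<^sup>+\<alpha>. ennreal (f (\<zeta> $ i) * exp (- \<alpha> * norm1 \<zeta>)) \<partial>?\<mu>) \<partial>lborel)"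
  proof (rule nn_integral_cong_AE)
    show "AE \<zeta> in lborel. ennreal (f (\<zeta> $ i) * kern m \<zeta>)
        = (\<integral>\<^sup>+\<alpha>. ennreal (f (\<zeta> $ i) * exp (- \<alpha> * norm1 (\<zeta>::real^'n))) \<partial>?\<mu>)"
      using AE_kern_eq_laplace[of m, where ?'n='n]
      by eventually_elim (simp add: ennreal_mult f0 kern_nonneg nn_integral_cmult)
  qed
  also have "\<dots> = (\<integral>\<^sup>+\<alpha>. (\<integral>\<^sup>+(\<zeta>::real^'n). ennreal (f (\<zeta> $ i) * exp (- \<alpha> * norm1 \<zeta>)) \<partial>lborel) \<partial>?\<mu>)"
    by (rule Fubini'[symmetric]) measurable
  also have "\<dots> = (\<integral>\<^sup>+\<alpha>. (\<integral>\<^sup>+t. ennreal (f t * exp (- \<alpha> * \<bar>t\<bar>)) \<partial>lborel) * ennreal ((2 / \<alpha>) ^ (CARD('n) - 1)) \<partial>?\<mu>)"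
  proof (rule nn_integral_cong_AE)
    show "AE \<alpha> in ?\<mu>. (\<integral>\<^sup>+(\<zeta>::real^'n). ennreal (f (\<zeta> $ i) * exp (- \<alpha> * norm1 \<zeta>)) \<partial>lborel)
        = (\<integral>\<^sup>+t. ennreal (f t * exp (- \<alpha> * \<bar>t\<bar>)) \<partial>lborel) * ennreal ((2 / \<alpha>) ^ (CARD('n) - 1))"
      using AE_laplace_measure_pos[OF m] by eventually_elim (intro nn_integral_exp_norm1_coordinate assms)
  qed
  finally show ?thesis .
qed

text \<open>\<open>weight k \<alpha>\<close> (with \<open>k = d - 2\<close>) collects the integral \<open>(2/\<alpha>)^(d-1)\<close> of \<open>exp(-\<alpha>\<bar>\<cdot>\<bar>)\<close>
  over the directions orthogonal to the stripes and the factor \<open>2/\<alpha>^2\<close> from the stripe direction.\<close>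

definition weight :: "nat \<Rightarrow> real \<Rightarrow> real" where
  "weight k \<alpha> = (2 / \<alpha>) ^ (k + 2) / \<alpha>"

text \<open>The function \<open>T\<close> of the overview: half of the nonlocal term of one period,
  per unit area of cross section.\<close>

definition stripe_energy :: "nat \<Rightarrow> real \<Rightarrow> real \<Rightarrow> real" where
  "stripe_energy k m h = (\<integral>\<alpha>. weight k \<alpha> * tanh (\<alpha> * h / 2) \<partial>laplace_measure k m)"

text \<open>The first moment of \<open>kern m\<close> cut off at distance \<open>R\<close> in one
  direction. \<open>Jtilde\<close> is the case \<open>m = 1\<close>, \<open>R = M\<close>;
  \<open>JM\<close> is a multiple of the case \<open>m = M\<close>, \<open>R = 1\<close>.\<close>

definition cutoff_moment :: "nat \<Rightarrow> real \<Rightarrow> real \<Rightarrow> real" where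
  "cutoff_moment k m R = (\<integral>\<alpha>. weight k \<alpha> * (1 - exp (- \<alpha> * R) * (1 + \<alpha> * R)) \<partial>laplace_measure k m)"

lemma weight_borel [measurable]: "weight k \<in> borel_measurable borel"
  unfolding weight_def[abs_def] by measurable

lemma weight_pos: "\<alpha> > 0 \<Longrightarrow> weight k \<alpha> > 0"
  by (simp add: weight_def)

text \<open>\<open>weight k \<alpha> * \<alpha>\<close> is \<open>(2 / \<alpha>) ^ (k + 2)\<close>,
  the total mass of \<open>exp(-\<alpha> r)\<close> in dimension \<open>k + 2\<close>. It dominates
  all integrands that follow and also gives the Lipschitz constant of \<open>T\<close>.\<close>

lemma integrable_weight_mult_id:
  assumes m: "m > 0"
  shows "integrable (laplace_measure k m) (\<lambda>\<alpha>. weight k \<alpha> * \<alpha>)"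
proof (rule integrableI_bounded)
  have "(\<integral>\<^sup>+\<alpha>. ennreal (norm (weight k \<alpha> * \<alpha>)) \<partial>laplace_measure k m)
      = (\<integral>\<^sup>+\<alpha>. ennreal (2 ^ (k + 2)) * ennreal (1 / \<alpha> ^ (k + 2)) \<partial>laplace_measure k m)"
    using AE_laplace_measure_pos[OF m, of k]
    by (intro nn_integral_cong_AE)
       (auto elim!: eventually_mono simp: weight_def power_divide ennreal_mult[symmetric])
  also have "\<dots> < \<infinity>"
    using nn_integral_laplace_measure_finite[OF m, of k]
    by (subst nn_integral_cmult) (auto simp: ennreal_mult_less_top)
  finally show "(\<integral>\<^sup>+\<alpha>. ennreal (norm (weight k \<alpha> * \<alpha>)) \<partial>laplace_measure k m) < \<infinity>" .
qed simp

lemma integrable_weight_bounded: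
  assumes m: "m > 0" and g [measurable]: "g \<in> borel_measurable borel"
    and b: "\<And>\<alpha>. \<alpha> > 0 \<Longrightarrow> \<bar>g \<alpha>\<bar> \<le> 1"
  shows "integrable (laplace_measure k m) (\<lambda>\<alpha>. weight k \<alpha> * g \<alpha>)"
proof (rule Bochner_Integration.integrable_bound)
  show "integrable (laplace_measure k m) (\<lambda>\<alpha>. 1 / m * (weight k \<alpha> * \<alpha>))"
    by (intro integrable_mult_right integrable_weight_mult_id m)
  show "AE \<alpha> in laplace_measure k m. norm (weight k \<alpha> * g \<alpha>) \<le> norm (1 / m * (weight k \<alpha> * \<alpha>))"
    using AE_laplace_measure[of m k]
  proof eventually_elim
    case (elim \<alpha>)
    \<comment> \<open>The measure lives on \<alpha> \<ge> m, so the bound 1 may be replaced by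
      \<alpha>/m.\<close>
    then have "\<bar>g \<alpha>\<bar> \<le> \<alpha> / m"
      using b[of \<alpha>] m by (intro order.trans[OF b]) (auto simp: field_simps)
    then have "weight k \<alpha> * \<bar>g \<alpha>\<bar> \<le> weight k \<alpha> * (\<alpha> / m)"
      using weight_pos[of \<alpha> k] elim m by (intro mult_left_mono) auto
    then show ?case
      using weight_pos[of \<alpha> k] elim m by (simp add: abs_mult mult_ac)
  qed
qed simp

text \<open>All but the upper bound 1 come from the strict inequality \<open>1 + x < exp x\<close>,
  at \<open>x = y\<close> and at \<open>x = - y\<close>. The comparison with \<open>tanh\<close> is
  the pointwise form of \<open>J < T(R)\<close>: cleared of denominators and divided by
  \<open>exp (- y)\<close>, it reads \<open>1 < exp (- y) + y + exp (- y) * y\<close>.\<close>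

lemma one_minus_exp_bounds:
  assumes "y > (0::real)"
  shows "0 < 1 - exp (- y) * (1 + y)" "1 - exp (- y) * (1 + y) < 1" "1 - exp (- y) * (1 + y) < tanh (y / 2)"
proof -
  \<comment> \<open>Strictness is gained by squaring the weak inequality at \<open>x / 2\<close>,
    which leaves the surplus \<open>x^2/4\<close>.\<close>
  have strict: "1 + x < exp x" if "x \<noteq> 0" for x :: real
  proof (cases "1 + x / 2 \<ge> 0")
    case True
    have "1 + x < (1 + x / 2)\<^sup>2"
      using that by (simp add: power2_sum field_simps)
    also have "\<dots> \<le> (exp (x / 2))\<^sup>2"
      using True exp_ge_add_one_self[of "x / 2"] by (intro power_mono) auto
    also have "\<dots> = exp x"
      by (simp add: exp_double[symmetric])
    finally show ?thesis .
  next
    case False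
    then have "1 + x < 0" by simp
    then show ?thesis using exp_gt_zero[of x] by linarith
  qed
  define e where "e = exp (- y)"
  have e: "e > 0" "e * exp y = 1"
    by (auto simp: e_def exp_add[symmetric])
  have "e * (1 + y) < e * exp y"
    using strict[of y] assms e by (intro mult_strict_left_mono) auto
  then show "0 < 1 - exp (- y) * (1 + y)"
    using e unfolding e_def by simp
  show "1 - exp (- y) * (1 + y) < 1"
    using assms by simp
  have "1 - y < e"
    using strict[of "- y"] assms by (simp add: e_def)
  then have "1 < e + y + e * y"
    using mult_pos_pos[OF e(1) assms] by linarith
  then have "e * 1 < e * (e + y + e * y)"
    using e by (intro mult_strict_left_mono)
  then have "(1 - exp (- y) * (1 + y)) * (1 + exp (- y)) < 1 - exp (- y)"
    unfolding e_def[symmetric] by (simp add: algebra_simps)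
  then show "1 - exp (- y) * (1 + y) < tanh (y / 2)"
    by (simp add: tanh_real_altdef pos_less_divide_eq add_pos_pos)
qed

lemma integrable_weight_tanh:
  "m > 0 \<Longrightarrow> integrable (laplace_measure k m) (\<lambda>\<alpha>. weight k \<alpha> * tanh (\<alpha> * h / 2))"
  by (rule integrable_weight_bounded) (auto simp: abs_le_iff less_imp_le[OF tanh_real_lt_1] less_imp_le[OF tanh_real_gt_neg1] minus_le_iff)

lemma integrable_weight_cutoff:
  assumes "m > 0" "R > 0"
  shows "integrable (laplace_measure k m) (\<lambda>\<alpha>. weight k \<alpha> * (1 - exp (- \<alpha> * R) * (1 + \<alpha> * R)))"
proof (rule integrable_weight_bounded[OF assms(1)])
  fix \<alpha> :: real assume "\<alpha> > 0"
  then show "\<bar>1 - exp (- \<alpha> * R) * (1 + \<alpha> * R)\<bar> \<le> 1"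
    using one_minus_exp_bounds(1,2)[of "\<alpha> * R"] assms by simp
qed simp

lemma weight_eq:
  assumes "CARD('n::finite) \<ge> 2"
  shows "2 / \<alpha>\<^sup>2 * (2 / \<alpha>) ^ (CARD('n) - 1) = weight (CARD('n) - 2) \<alpha>"
proof -
  obtain k where "CARD('n) = Suc (Suc k)"
    using assms by (metis le_Suc_ex add_2_eq_Suc)
  then show ?thesis
    by (simp add: weight_def power2_eq_square)
qed

lemma integrable_kern:
  assumes m: "m > 0" and n: "CARD('n::finite) \<ge> 2"
  shows "integrable lborel (kern m :: real^'n \<Rightarrow> real)"
proof (rule integrableI_bounded)
  have "(\<integral>\<^sup>+(\<zeta>::real^'n). ennreal (norm (kern m \<zeta>)) \<partial>lborel) = (\<integral>\<^sup>+(\<zeta>::real^'n). ennreal ((\<lambda>_. 1) (\<zeta> $ undefined) * kern m \<zeta>) \<partial>lborel)"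
    by (simp add: kern_nonneg)
  also have "\<dots> = (\<integral>\<^sup>+\<alpha>. (\<integral>\<^sup>+t. ennreal ((\<lambda>_. 1) t * exp (- \<alpha> * \<bar>t\<bar>)) \<partial>lborel) * ennreal ((2 / \<alpha>) ^ (CARD('n) - 1))
        \<partial>laplace_measure (CARD('n) - 2) m)"
    by (rule nn_integral_kern_coordinate[OF _ m]) auto
  also have "\<dots> = (\<integral>\<^sup>+\<alpha>. ennreal (norm (weight (CARD('n) - 2) \<alpha> * \<alpha>)) \<partial>laplace_measure (CARD('n) - 2) m)"
  proof (rule nn_integral_cong_AE)
    show "AE \<alpha> in laplace_measure (CARD('n) - 2) m.
        (\<integral>\<^sup>+t. ennreal ((\<lambda>_. 1) t * exp (- \<alpha> * \<bar>t\<bar>)) \<partial>lborel) * ennreal ((2 / \<alpha>) ^ (CARD('n) - 1))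
        = ennreal (norm (weight (CARD('n) - 2) \<alpha> * \<alpha>))"
      using AE_laplace_measure_pos[OF m]
    proof eventually_elim
      case (elim \<alpha>)
      have "weight (CARD('n) - 2) \<alpha> * \<alpha> = 2 / \<alpha> * (2 / \<alpha>) ^ (CARD('n) - 1)"
        unfolding weight_eq[OF n, symmetric] using elim by (simp add: power2_eq_square)
      moreover have "(\<integral>\<^sup>+t. ennreal ((\<lambda>_. 1) t * exp (- \<alpha> * \<bar>t\<bar>)) \<partial>lborel) = ennreal (2 / \<alpha>)"
        using nn_integral_exp_abs[OF elim] by simp
      ultimately show ?case
        using elim by (simp add: ennreal_mult[symmetric])
    qed
  qed
  also have "\<dots> < \<infinity>"
    using integrable_weight_mult_id[OF m, of "CARD('n) - 2"] unfolding integrable_iff_bounded by simp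
  finally show "(\<integral>\<^sup>+(\<zeta>::real^'n). ennreal (norm (kern m \<zeta>)) \<partial>lborel) < \<infinity>" .
qed simp

lemma integral_cutoff_kern:
  fixes i :: "'n::finite"
  assumes m: "m > 0" and R: "R > 0" and n: "CARD('n) \<ge> 2"
  shows "(\<integral>\<zeta>. indicator {\<zeta>::real^'n. \<bar>\<zeta> $ i\<bar> \<le> R} \<zeta> * \<bar>\<zeta> $ i\<bar> * kern m \<zeta> \<partial>lborel) = cutoff_moment (CARD('n) - 2) m R"
proof -
  let ?\<mu> = "laplace_measure (CARD('n) - 2) m"
  let ?q = "\<lambda>\<alpha>. 1 - exp (- \<alpha> * R) * (1 + \<alpha> * R)"
  have q0: "0 \<le> ?q \<alpha>" if "\<alpha> > 0" for \<alpha>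
    using one_minus_exp_bounds(1)[of "\<alpha> * R"] that R by simp
  have "(\<integral>\<zeta>. indicator {\<zeta>::real^'n. \<bar>\<zeta> $ i\<bar> \<le> R} \<zeta> * \<bar>\<zeta> $ i\<bar> * kern m \<zeta> \<partial>lborel)
      = enn2real (\<integral>\<^sup>+\<zeta>. ennreal (indicator {\<zeta>::real^'n. \<bar>\<zeta> $ i\<bar> \<le> R} \<zeta> * \<bar>\<zeta> $ i\<bar> * kern m \<zeta>) \<partial>lborel)"
    by (rule integral_eq_nn_integral) (auto simp: kern_nonneg)
  also have "(\<integral>\<^sup>+\<zeta>. ennreal (indicator {\<zeta>::real^'n. \<bar>\<zeta> $ i\<bar> \<le> R} \<zeta> * \<bar>\<zeta> $ i\<bar> * kern m \<zeta>) \<partial>lborel)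
      = (\<integral>\<^sup>+(\<zeta>::real^'n). ennreal ((\<lambda>t. indicator {-R..R} t * \<bar>t\<bar>) (\<zeta> $ i) * kern m \<zeta>) \<partial>lborel)"
    by (intro nn_integral_cong) (auto simp: indicator_def abs_le_iff minus_le_iff)
  also have "\<dots> = (\<integral>\<^sup>+\<alpha>. (\<integral>\<^sup>+t. ennreal ((\<lambda>t. indicator {-R..R} t * \<bar>t\<bar>) t * exp (- \<alpha> * \<bar>t\<bar>)) \<partial>lborel)
      * ennreal ((2 / \<alpha>) ^ (CARD('n) - 1)) \<partial>?\<mu>)"
    by (rule nn_integral_kern_coordinate[OF _ m]) auto
  also have "\<dots> = (\<integral>\<^sup>+\<alpha>. ennreal (weight (CARD('n) - 2) \<alpha> * ?q \<alpha>) \<partial>?\<mu>)"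
  proof (rule nn_integral_cong_AE)
    show "AE \<alpha> in ?\<mu>. (\<integral>\<^sup>+t. ennreal ((\<lambda>t. indicator {-R..R} t * \<bar>t\<bar>) t * exp (- \<alpha> * \<bar>t\<bar>)) \<partial>lborel)
      * ennreal ((2 / \<alpha>) ^ (CARD('n) - 1)) = ennreal (weight (CARD('n) - 2) \<alpha> * ?q \<alpha>)"
      using AE_laplace_measure_pos[OF m]
    proof eventually_elim
      case (elim \<alpha>)
      then show ?case
        using q0[OF elim] R
        unfolding weight_eq[OF n, of \<alpha>, symmetric]
        by (subst nn_integral_abs_exp_abs) (auto simp: ennreal_mult[symmetric] mult_ac)
    qed
  qed
  also have "enn2real \<dots> = cutoff_moment (CARD('n) - 2) m R"
    unfolding cutoff_moment_def
  proof (rule integral_eq_nn_integral[symmetric])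
    show "AE \<alpha> in ?\<mu>. 0 \<le> weight (CARD('n) - 2) \<alpha> * ?q \<alpha>"
      using AE_laplace_measure_pos[OF m]
      by eventually_elim (intro mult_nonneg_nonneg less_imp_le[OF weight_pos] q0)
  qed simp
  finally show ?thesis .
qed

lemma Eh_iff: "x \<in> Eh h \<longleftrightarrow> x $ dir1 \<in> stripes h"
  by (simp add: Eh_def stripes_def)

text \<open>Membership in \<open>Eh h\<close> depends on \<open>dir1\<close> alone, so the double
  integral collapses to one over a period of the line; for each \<alpha> that period contributes a
  multiple of \<open>tanh (\<alpha> * h / 2)\<close>.\<close>

lemma nonlocal_Eh:
  assumes m: "m > 0" and h: "h > 0" and n: "CARD('n::finite) \<ge> 2"
  shows "nonlocal (kern m) (Eh h :: (real^'n) set) (2 * h)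
    = (2 * h) ^ (CARD('n) - 1) * (2 * stripe_energy (CARD('n) - 2) m h)"
proof -
  let ?\<mu> = "laplace_measure (CARD('n) - 2) m"
  let ?w = "weight (CARD('n) - 2)"
  interpret \<mu>: sigma_finite_measure ?\<mu> by (rule sigma_finite_laplace_measure)
  interpret pair_sigma_finite "lborel :: real measure" ?\<mu> ..
  define u where "u = (\<lambda>s t. \<bar>indicator (stripes h) (s + t) - indicator (stripes h) s :: real\<bar>)"
  have u [measurable]: "(\<lambda>(s, t). u s t) \<in> borel_measurable borel"
    unfolding u_def borel_prod[symmetric] by measurable
  have u01: "0 \<le> u s t" "u s t \<le> 1" for s t
    by (auto simp: u_def indicator_def)
  define G where "G = (\<lambda>s. \<integral>\<^sup>+(\<zeta>::real^'n). ennreal (u s (\<zeta> $ dir1) * kern m \<zeta>) \<partial>lborel)"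
  have [measurable]: "(\<lambda>(s, \<alpha>). stripe_interaction h \<alpha> s) \<in> borel_measurable (lborel \<Otimes>\<^sub>M ?\<mu>)"
    unfolding stripe_interaction_def by measurable
  have G: "G s = (\<integral>\<^sup>+\<alpha>. stripe_interaction h \<alpha> s * ennreal ((2 / \<alpha>) ^ (CARD('n) - 1)) \<partial>?\<mu>)" for s
    unfolding G_def stripe_interaction_def u_def
    by (rule nn_integral_kern_coordinate[OF _ m]) auto
  have [measurable]: "G \<in> borel_measurable borel"
    unfolding G by measurable
  \<comment> \<open>\<open>enn2real\<close> sends infinity to 0, so finiteness is required before
    passing from the Lebesgue integral back to \<open>G\<close>.\<close>
  have G_fin: "G s < \<infinity>" for s
  proof -
    have "G s \<le> (\<integral>\<^sup>+(\<zeta>::real^'n). ennreal (norm (kern m \<zeta>)) \<partial>lborel)"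
      unfolding G_def using u01 by (intro nn_integral_mono ennreal_leI) (auto simp: kern_nonneg mult_left_le_one_le)
    also have "\<dots> < \<infinity>"
      using integrable_kern[OF m n] unfolding integrable_iff_bounded by simp
    finally show ?thesis .
  qed
  have inner: "(LINT \<zeta>|lborel. \<bar>indicator (Eh h) (x + \<zeta>) - indicator (Eh h) x\<bar> * kern m \<zeta>) = enn2real (G (x $ dir1))"
    for x :: "real^'n"
  proof -
    have "(LINT \<zeta>|lborel. \<bar>indicator (Eh h) (x + \<zeta>) - indicator (Eh h) x\<bar> * kern m \<zeta>)
        = (LINT (\<zeta>::real^'n)|lborel. u (x $ dir1) (\<zeta> $ dir1) * kern m \<zeta>)"
      by (intro Bochner_Integration.integral_cong) (auto simp: u_def Eh_iff indicator_def)
    also have "\<dots> = enn2real (G (x $ dir1))"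
      unfolding G_def
      by (rule integral_eq_nn_integral) (auto simp: kern_nonneg u01 u_def)
    finally show ?thesis .
  qed
  have "nonlocal (kern m) (Eh h :: (real^'n) set) (2 * h)
      = (\<integral>(x::real^'n). indicator (cube (2 * h)) x * enn2real (G (x $ dir1)) \<partial>lborel)"
    unfolding nonlocal_def set_lebesgue_integral_def inner by simp
  also have "\<dots> = enn2real (\<integral>\<^sup>+(x::real^'n). ennreal (indicator (cube (2 * h)) x * enn2real (G (x $ dir1))) \<partial>lborel)"
    by (rule integral_eq_nn_integral) (auto simp: cube_borel)
  also have "(\<integral>\<^sup>+(x::real^'n). ennreal (indicator (cube (2 * h)) x * enn2real (G (x $ dir1))) \<partial>lborel)
      = (\<integral>\<^sup>+(x::real^'n). indicator (cube (2 * h)) x * G (x $ dir1) \<partial>lborel)"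
    using G_fin by (intro nn_integral_cong) (auto simp: indicator_def)
  also have "\<dots> = ennreal ((2 * h) ^ (CARD('n) - 1)) * (\<integral>\<^sup>+s. indicator {0..<2 * h} s * G s \<partial>lborel)"
    by (rule nn_integral_cube_coordinate) (use h in auto)
  also have "(\<integral>\<^sup>+s. indicator {0..<2 * h} s * G s \<partial>lborel)
      = (\<integral>\<^sup>+s. (\<integral>\<^sup>+\<alpha>. indicator {0..<2 * h} s * stripe_interaction h \<alpha> s * ennreal ((2 / \<alpha>) ^ (CARD('n) - 1)) \<partial>?\<mu>) \<partial>lborel)"
    unfolding G by (subst nn_integral_cmult[symmetric]) (auto simp: mult.assoc)
  \<comment> \<open>A second use of Tonelli: averaging over the period before integrating in
    \<alpha> makes the closed form of the interaction available.\<close>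
  also have "\<dots> = (\<integral>\<^sup>+\<alpha>. (\<integral>\<^sup>+s. indicator {0..<2 * h} s * stripe_interaction h \<alpha> s * ennreal ((2 / \<alpha>) ^ (CARD('n) - 1)) \<partial>lborel) \<partial>?\<mu>)"
    by (rule Fubini'[symmetric]) measurable
  also have "\<dots> = (\<integral>\<^sup>+\<alpha>. ennreal (2 * (?w \<alpha> * tanh (\<alpha> * h / 2))) \<partial>?\<mu>)"
  proof (rule nn_integral_cong_AE)
    show "AE \<alpha> in ?\<mu>. (\<integral>\<^sup>+s. indicator {0..<2 * h} s * stripe_interaction h \<alpha> s * ennreal ((2 / \<alpha>) ^ (CARD('n) - 1)) \<partial>lborel)
        = ennreal (2 * (?w \<alpha> * tanh (\<alpha> * h / 2)))"
      using AE_laplace_measure_pos[OF m]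
    proof eventually_elim
      case (elim \<alpha>)
      have [measurable]: "stripe_interaction h \<alpha> \<in> borel_measurable borel"
        unfolding stripe_interaction_def[abs_def] by measurable
      have "0 \<le> tanh (\<alpha> * h / 2)" using elim h by simp
      have "(\<integral>\<^sup>+s. indicator {0..<2 * h} s * stripe_interaction h \<alpha> s * ennreal ((2 / \<alpha>) ^ (CARD('n) - 1)) \<partial>lborel)
          = ennreal (4 / \<alpha>\<^sup>2 * tanh (\<alpha> * h / 2)) * ennreal ((2 / \<alpha>) ^ (CARD('n) - 1))"
        by (subst nn_integral_multc) (simp_all only: nn_integral_stripe_interaction[OF elim h], measurable)
      also have "\<dots> = ennreal (4 / \<alpha>\<^sup>2 * tanh (\<alpha> * h / 2) * (2 / \<alpha>) ^ (CARD('n) - 1))"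
        using elim \<open>0 \<le> tanh (\<alpha> * h / 2)\<close> by (intro ennreal_mult[symmetric]) auto
      also have "4 / \<alpha>\<^sup>2 * tanh (\<alpha> * h / 2) * (2 / \<alpha>) ^ (CARD('n) - 1) = 2 * (?w \<alpha> * tanh (\<alpha> * h / 2))"
        unfolding weight_eq[OF n, of \<alpha>, symmetric] by simp
      finally show ?case .
    qed
  qed
  also have "enn2real (ennreal ((2 * h) ^ (CARD('n) - 1)) * \<dots>)
      = (2 * h) ^ (CARD('n) - 1) * enn2real (\<integral>\<^sup>+\<alpha>. ennreal (2 * (?w \<alpha> * tanh (\<alpha> * h / 2))) \<partial>?\<mu>)"
    using h by (simp add: enn2real_mult)
  also have "enn2real (\<integral>\<^sup>+\<alpha>. ennreal (2 * (?w \<alpha> * tanh (\<alpha> * h / 2))) \<partial>?\<mu>)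
      = (\<integral>\<alpha>. 2 * (?w \<alpha> * tanh (\<alpha> * h / 2)) \<partial>?\<mu>)"
  proof (rule integral_eq_nn_integral[symmetric])
    show "AE \<alpha> in ?\<mu>. 0 \<le> 2 * (?w \<alpha> * tanh (\<alpha> * h / 2))"
      using AE_laplace_measure_pos[OF m]
    proof eventually_elim
      case (elim \<alpha>)
      then show ?case
        using h weight_pos[OF elim, of "CARD('n) - 2"] by simp
    qed
  qed simp
  also have "\<dots> = 2 * stripe_energy (CARD('n) - 2) m h"
    unfolding stripe_energy_def by simp
  finally show ?thesis .
qed

section \<open>The stripe energy as a function of the width\<close>

text \<open>The derivative \<open>1 - tanh^2\<close> decreases strictly on the positive axis; the
  mean value theorem on the two halves compares the increments.\<close>

lemma tanh_midpoint:
  assumes "0 < x" "x < (y::real)"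
  shows "tanh x + tanh y < 2 * tanh ((x + y) / 2)"
proof -
  define z where "z = (x + y) / 2"
  have z: "x < z" "z < y" "z - x = y - z" "z > x"
    using assms by (auto simp: z_def field_simps)
  have der: "(tanh has_real_derivative 1 - (tanh t)\<^sup>2) (at t)" for t :: real
    by (auto intro!: derivative_eq_intros)
  obtain a where a: "x < a" "a < z" "tanh z - tanh x = (z - x) * (1 - (tanh a)\<^sup>2)"
    using MVT2[OF z(1), of tanh "\<lambda>t. 1 - (tanh t)\<^sup>2"] der by blast
  obtain b where b: "z < b" "b < y" "tanh y - tanh z = (y - z) * (1 - (tanh b)\<^sup>2)"
    using MVT2[OF z(2), of tanh "\<lambda>t. 1 - (tanh t)\<^sup>2"] der by blast
  have "(tanh a)\<^sup>2 < (tanh b)\<^sup>2"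
    using assms a b by (intro power_strict_mono) auto
  then have "tanh y - tanh z < tanh z - tanh x"
    unfolding a(3) b(3) z(3) using z by (intro mult_strict_left_mono) auto
  then show ?thesis
    unfolding z_def by simp
qed

lemma tanh_lipschitz: "\<bar>tanh x - tanh y\<bar> \<le> \<bar>x - (y::real)\<bar>"
proof -
  have "tanh b - tanh a \<le> b - a" if ab: "a < b" for a b :: real
  proof -
    have der: "(tanh has_real_derivative 1 - (tanh t)\<^sup>2) (at t)" for t :: real
      by (auto intro!: derivative_eq_intros)
    obtain c where "tanh b - tanh a = (b - a) * (1 - (tanh c)\<^sup>2)"
      using MVT2[OF ab, of tanh "\<lambda>t. 1 - (tanh t)\<^sup>2"] der by blast
    also have "\<dots> \<le> (b - a) * 1"
      using ab by (intro mult_left_mono) auto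
    finally show ?thesis by simp
  qed
  moreover have "tanh a \<le> tanh b" if "a < b" for a b :: real
    using that by simp
  ultimately show ?thesis
    by (smt (verit, best))
qed

text \<open>The measure is nonzero, since its Laplace transform at 1 is positive. This keeps
  integrated inequalities strict.\<close>

lemma laplace_measure_not_AE_False: "\<not> (AE \<alpha> in laplace_measure k m. False)"
proof
  assume "AE \<alpha> in laplace_measure k m. False"
  then have "(\<integral>\<^sup>+\<alpha>. ennreal (exp (- \<alpha> * 1)) \<partial>laplace_measure k m) = (\<integral>\<^sup>+\<alpha>. 0 \<partial>laplace_measure k m)"
    by (intro nn_integral_cong_AE) (auto elim: eventually_mono)
  then show False
    using nn_integral_laplace_measure_exp[of 1 k m] by simp
qed

lemma integral_laplace_less:
  assumes m: "m > 0" and f: "integrable (laplace_measure k m) f" and g: "integrable (laplace_measure k m) g"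
    and less: "\<And>\<alpha>. \<alpha> > 0 \<Longrightarrow> f \<alpha> < (g \<alpha> :: real)"
  shows "integral\<^sup>L (laplace_measure k m) f < integral\<^sup>L (laplace_measure k m) g"
proof -
  let ?\<mu> = "laplace_measure k m"
  have pos: "AE \<alpha> in ?\<mu>. 0 < g \<alpha> - f \<alpha>"
    using AE_laplace_measure_pos[OF m] by eventually_elim (simp add: less)
  have int: "integrable ?\<mu> (\<lambda>\<alpha>. g \<alpha> - f \<alpha>)"
    using f g by simp
  have nonneg: "AE \<alpha> in ?\<mu>. 0 \<le> g \<alpha> - f \<alpha>"
    using pos by eventually_elim simp
  have "(\<integral>\<alpha>. g \<alpha> - f \<alpha> \<partial>?\<mu>) \<noteq> 0"
  proof
    assume "(\<integral>\<alpha>. g \<alpha> - f \<alpha> \<partial>?\<mu>) = 0"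
    then have "AE \<alpha> in ?\<mu>. g \<alpha> - f \<alpha> = 0"
      by (rule iffD1[OF integral_nonneg_eq_0_iff_AE[OF int nonneg]])
    with pos have "AE \<alpha> in ?\<mu>. False"
      by eventually_elim simp
    then show False
      using laplace_measure_not_AE_False by blast
  qed
  moreover have "(\<integral>\<alpha>. g \<alpha> - f \<alpha> \<partial>?\<mu>) \<ge> 0"
    by (rule integral_nonneg_AE[OF nonneg])
  ultimately show ?thesis
    using f g by simp
qed

text \<open>The Lipschitz bound forces \<open>T\<close> to be small for thin stripes, and the upper
  bound controls wide ones; together they confine minimizers to a compact interval.\<close>

lemma stripe_energy_bounds:
  assumes m: "m > 0"
  obtains C P where "C > 0" "P > 0"
    "\<And>h h'. \<bar>stripe_energy k m h - stripe_energy k m h'\<bar> \<le> C * \<bar>h - h'\<bar>"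
    "\<And>h. stripe_energy k m h \<le> P"
proof
  let ?\<mu> = "laplace_measure k m"
  define C where "C = (\<integral>\<alpha>. weight k \<alpha> * \<alpha> \<partial>?\<mu>)"
  define P where "P = (\<integral>\<alpha>. weight k \<alpha> * 1 \<partial>?\<mu>)"
  have iP: "integrable ?\<mu> (\<lambda>\<alpha>. weight k \<alpha> * 1)"
    by (rule integrable_weight_bounded[OF m]) auto
  note iC = integrable_weight_mult_id[OF m, of k]
  note iT = integrable_weight_tanh[OF m, of k]
  show "C > 0"
    using integral_laplace_less[OF m _ iC, of "\<lambda>_. 0"] weight_pos by (simp add: C_def)
  show "P > 0"
    using integral_laplace_less[OF m _ iP, of "\<lambda>_. 0"] weight_pos by (simp add: P_def)
  show "stripe_energy k m h \<le> P" for h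
    unfolding stripe_energy_def P_def
  proof (rule integral_mono_AE[OF iT iP])
    show "AE \<alpha> in ?\<mu>. weight k \<alpha> * tanh (\<alpha> * h / 2) \<le> weight k \<alpha> * 1"
      using AE_laplace_measure_pos[OF m]
      by eventually_elim (intro mult_left_mono less_imp_le[OF weight_pos] less_imp_le[OF tanh_real_lt_1])
  qed
  show "\<bar>stripe_energy k m h - stripe_energy k m h'\<bar> \<le> C * \<bar>h - h'\<bar>" for h h'
  proof -
    have "stripe_energy k m h - stripe_energy k m h'
        = (\<integral>\<alpha>. weight k \<alpha> * tanh (\<alpha> * h / 2) - weight k \<alpha> * tanh (\<alpha> * h' / 2) \<partial>?\<mu>)"
      unfolding stripe_energy_def by (rule Bochner_Integration.integral_diff[symmetric, OF iT iT])
    also have "\<bar>\<dots>\<bar> \<le> (\<integral>\<alpha>. \<bar>weight k \<alpha> * tanh (\<alpha> * h / 2) - weight k \<alpha> * tanh (\<alpha> * h' / 2)\<bar> \<partial>?\<mu>)"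
      by (rule integral_abs_bound)
    also have "\<dots> \<le> (\<integral>\<alpha>. weight k \<alpha> * \<alpha> * \<bar>h - h'\<bar> \<partial>?\<mu>)"
    proof (rule integral_mono_AE)
      show "AE \<alpha> in ?\<mu>. \<bar>weight k \<alpha> * tanh (\<alpha> * h / 2) - weight k \<alpha> * tanh (\<alpha> * h' / 2)\<bar>
          \<le> weight k \<alpha> * \<alpha> * \<bar>h - h'\<bar>"
        using AE_laplace_measure_pos[OF m]
      proof eventually_elim
        case (elim \<alpha>)
        have "\<bar>tanh (\<alpha> * h / 2) - tanh (\<alpha> * h' / 2)\<bar> \<le> \<bar>\<alpha> * h / 2 - \<alpha> * h' / 2\<bar>"
          by (rule tanh_lipschitz)
        also have "\<alpha> * h / 2 - \<alpha> * h' / 2 = \<alpha> / 2 * (h - h')"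
          by (simp add: field_simps)
        also have "\<bar>\<alpha> / 2 * (h - h')\<bar> = \<alpha> / 2 * \<bar>h - h'\<bar>"
          using elim by (simp add: abs_mult)
        also have "\<dots> \<le> \<alpha> * \<bar>h - h'\<bar>"
          using elim by (intro mult_right_mono) auto
        finally have "weight k \<alpha> * \<bar>tanh (\<alpha> * h / 2) - tanh (\<alpha> * h' / 2)\<bar> \<le> weight k \<alpha> * (\<alpha> * \<bar>h - h'\<bar>)"
          by (intro mult_left_mono less_imp_le[OF weight_pos[OF elim]])
        then show ?case
          using weight_pos[OF elim, of k] by (simp add: right_diff_distrib[symmetric] abs_mult mult.assoc)
      qed
    qed (use iT iC in auto)
    also have "\<dots> = C * \<bar>h - h'\<bar>"
      unfolding C_def by simp
    finally show ?thesis .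
  qed
qed

lemma stripe_energy_midpoint:
  assumes m: "m > 0" and "0 < a" "a < b"
  shows "stripe_energy k m a + stripe_energy k m b < 2 * stripe_energy k m ((a + b) / 2)"
proof -
  let ?\<mu> = "laplace_measure k m"
  note iT = integrable_weight_tanh[OF m, of k]
  have "stripe_energy k m a + stripe_energy k m b
      = (\<integral>\<alpha>. weight k \<alpha> * tanh (\<alpha> * a / 2) + weight k \<alpha> * tanh (\<alpha> * b / 2) \<partial>?\<mu>)"
    unfolding stripe_energy_def by (rule Bochner_Integration.integral_add[symmetric, OF iT iT])
  also have "\<dots> < (\<integral>\<alpha>. 2 * (weight k \<alpha> * tanh (\<alpha> * ((a + b) / 2) / 2)) \<partial>?\<mu>)"
  proof (rule integral_laplace_less[OF m])
    fix \<alpha> :: real assume \<alpha>: "\<alpha> > 0"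
    have "tanh (\<alpha> * a / 2) + tanh (\<alpha> * b / 2) < 2 * tanh ((\<alpha> * a / 2 + \<alpha> * b / 2) / 2)"
      using \<alpha> assms by (intro tanh_midpoint) auto
    also have "(\<alpha> * a / 2 + \<alpha> * b / 2) / 2 = \<alpha> * ((a + b) / 2) / 2"
      by (simp add: field_simps)
    finally have "weight k \<alpha> * (tanh (\<alpha> * a / 2) + tanh (\<alpha> * b / 2)) < weight k \<alpha> * (2 * tanh (\<alpha> * ((a + b) / 2) / 2))"
      by (intro mult_strict_left_mono weight_pos \<alpha>)
    then show "weight k \<alpha> * tanh (\<alpha> * a / 2) + weight k \<alpha> * tanh (\<alpha> * b / 2)
        < 2 * (weight k \<alpha> * tanh (\<alpha> * ((a + b) / 2) / 2))"
      by (simp add: algebra_simps)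
  qed (intro Bochner_Integration.integrable_add integrable_mult_right iT)+
  also have "\<dots> = 2 * stripe_energy k m ((a + b) / 2)"
    unfolding stripe_energy_def by simp
  finally show ?thesis .
qed

lemma cutoff_moment_bounds:
  assumes m: "m > 0" and R: "R > 0"
  shows "0 < cutoff_moment k m R" "cutoff_moment k m R < stripe_energy k m R"
proof -
  have "(\<integral>\<alpha>. 0 \<partial>laplace_measure k m) < cutoff_moment k m R"
    unfolding cutoff_moment_def
  proof (rule integral_laplace_less[OF m _ integrable_weight_cutoff[OF m R]])
    fix \<alpha> :: real assume "\<alpha> > 0"
    then show "0 < weight k \<alpha> * (1 - exp (- \<alpha> * R) * (1 + \<alpha> * R))"
      using one_minus_exp_bounds(1)[of "\<alpha> * R"] R weight_pos by (intro mult_pos_pos) auto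
  qed simp
  then show "0 < cutoff_moment k m R" by simp
  show "cutoff_moment k m R < stripe_energy k m R"
    unfolding cutoff_moment_def stripe_energy_def
  proof (rule integral_laplace_less[OF m integrable_weight_cutoff[OF m R] integrable_weight_tanh[OF m]])
    fix \<alpha> :: real assume "\<alpha> > 0"
    then show "weight k \<alpha> * (1 - exp (- \<alpha> * R) * (1 + \<alpha> * R)) < weight k \<alpha> * tanh (\<alpha> * R / 2)"
      using one_minus_exp_bounds(3)[of "\<alpha> * R"] R by (intro mult_strict_left_mono weight_pos) auto
  qed
qed

text \<open>The quotient is negative at \<open>R\<close> but nonnegative for small \<open>h\<close>,
  and for large \<open>h\<close> it is too close to 0 to reach the value at \<open>R\<close>;
  compactness gives a minimizer. If two points shared the minimal value \<open>c\<close>, the graph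
  of \<open>T\<close> would meet the line \<open>J - c * h\<close> at both and lie strictly above it
  at their midpoint.\<close>

lemma unique_minimizer:
  fixes T :: "real \<Rightarrow> real"
  assumes J: "0 < J" "J < T R" and R: "0 < R" and T0: "T 0 = 0"
    and lip: "C > 0" "\<And>h h'. \<bar>T h - T h'\<bar> \<le> C * \<bar>h - h'\<bar>"
    and bdd: "P > 0" "\<And>h. T h \<le> P"
    and mid: "\<And>a b. 0 < a \<Longrightarrow> a < b \<Longrightarrow> T a + T b < 2 * T ((a + b) / 2)"
  shows "\<exists>!h. 0 < h \<and> (\<forall>h'>0. (J - T h) / h \<le> (J - T h') / h')"
proof -
  define g where "g = (\<lambda>h. (J - T h) / h)"
  have gR: "g R < 0"
    using J R by (simp add: g_def divide_neg_pos)
  \<comment> \<open>Up to \<open>a\<close>, \<open>T h \<le> C * h \<le> J\<close> keeps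
    \<open>g\<close> nonnegative. From \<open>b\<close> on, \<open>- P / h\<close> is at least
    \<open>g R\<close>, and \<open>J > 0\<close> makes \<open>g h\<close> strictly larger.\<close>
  define a where "a = J / C"
  define b where "b = P / - g R"
  have a: "a > 0" and b: "b > 0"
    unfolding a_def b_def using J lip bdd gR by (simp_all add: divide_pos_neg)
  have small: "g h > g R" if "0 < h" "h \<le> a" for h
  proof -
    have "T h \<le> C * h"
      using lip(2)[of h 0] that T0 by simp
    also have "\<dots> \<le> J"
      using that lip(1) by (simp add: a_def field_simps)
    finally have "g h \<ge> 0"
      using that by (simp add: g_def)
    with gR show ?thesis by simp
  qed
  have large: "g h > g R" if "b \<le> h" for h
  proof -
    have h: "h > 0" using b that by simp
    have "P \<le> - g R * h"
      using that gR by (simp add: b_def field_simps)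
    then have "g R * h < J - T h"
      using J(1) bdd(2)[of h] by simp
    then show ?thesis
      using h by (simp add: g_def pos_less_divide_eq)
  qed
  \<comment> \<open>Otherwise \<open>small\<close> or \<open>large\<close>, applied at
    \<open>R\<close> itself, would give \<open>g R > g R\<close>.\<close>
  have Rab: "a < R" "R < b"
    using small[of R] large[of R] R by force+
  have "C-lipschitz_on UNIV T"
    using lip by (intro lipschitz_onI) (auto simp: dist_real_def)
  then have "continuous_on UNIV T"
    by (rule lipschitz_on_continuous_on)
  then have "continuous_on {a..b} g"
    unfolding g_def using a by (intro continuous_intros) (auto intro: continuous_on_subset)
  then obtain h0 where h0: "h0 \<in> {a..b}" "\<And>h. h \<in> {a..b} \<Longrightarrow> g h0 \<le> g h"
    using continuous_attains_inf[of "{a..b}" g] Rab by auto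
  have min0: "g h0 \<le> g h" if "h > 0" for h
  proof (cases "h \<in> {a..b}")
    case False
    then have "g R < g h"
      using small[of h] large[of h] that by auto
    moreover have "g h0 \<le> g R"
      using Rab by (intro h0) auto
    ultimately show ?thesis by simp
  qed (rule h0)
  have uniq: "False" if "0 < x" "x < y" "\<And>h. h > 0 \<Longrightarrow> g x \<le> g h" "g y \<le> g x" for x y
  proof -
    define z where "z = (x + y) / 2"
    have z: "z > 0" using that by (simp add: z_def)
    have "T x = J - g x * x" "T y = J - g y * y"
      using that by (auto simp: g_def)
    moreover have "g y = g x" using that by (intro antisym) auto
    ultimately have "2 * J - 2 * (g x * z) < 2 * T z"
      using mid[OF that(1,2)] by (simp add: z_def field_simps)
    then have "g z < g x"
      using z by (simp add: g_def[THEN fun_cong, of z] pos_divide_less_eq)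
    with that(3)[OF z] show False by simp
  qed
  show ?thesis
    unfolding g_def[THEN fun_cong, symmetric]
  proof (rule ex1I[of _ h0])
    show "0 < h0 \<and> (\<forall>h'>0. g h0 \<le> g h')"
      using h0(1) a min0 by auto
  next
    fix h assume h: "0 < h \<and> (\<forall>h'>0. g h \<le> g h')"
    have "h0 > 0" using h0(1) a by auto
    show "h = h0"
      using uniq[of h h0] uniq[of h0 h] h min0 \<open>h0 > 0\<close> by (meson linorder_neqE_linordered_idom)
  qed
qed

section \<open>The minimal stripe energy is negative\<close>

lemma K1_eq_kern: "K1 = kern 1"
  by (simp add: K1_def kern_def fun_eq_iff)

lemma Jtilde_eq:
  assumes "M > 0" "CARD('n::finite) \<ge> 2"
  shows "Jtilde TYPE('n) M = cutoff_moment (CARD('n) - 2) 1 M"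
  unfolding Jtilde_def K1_eq_kern using integral_cutoff_kern[of 1 M dir1] assms by simp

text \<open>The difference of indicators is at most 1. \<open>E\<close> can be arbitrary because
  \<open>integral_mono'\<close> asks for integrability of the dominating function only.\<close>

lemma nonlocal_K1_le:
  fixes E :: "(real^'n::finite) set"
  assumes n: "CARD('n) \<ge> 2" and L: "L > 0"
  shows "nonlocal K1 E L \<le> L ^ CARD('n) * (\<integral>(\<zeta>::real^'n). kern 1 \<zeta> \<partial>lborel)"
proof -
  let ?c = "\<integral>(\<zeta>::real^'n). kern 1 \<zeta> \<partial>lborel"
  have int: "integrable lborel (kern 1 :: real^'n \<Rightarrow> real)"
    by (rule integrable_kern) (use n in auto)
  have inner: "(LINT \<zeta>|lborel. \<bar>indicator E (x + \<zeta>) - indicator E x\<bar> * K1 \<zeta>) \<le> ?c" for x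
    unfolding K1_eq_kern by (rule integral_mono'[OF int]) (auto simp: indicator_def kern_nonneg)
  have "nonlocal K1 E L \<le> (\<integral>(x::real^'n). indicator (cube L) x * ?c \<partial>lborel)"
    unfolding nonlocal_def set_lebesgue_integral_def
  proof (rule integral_mono')
    show "integrable lborel (\<lambda>x::real^'n. indicator (cube L) x * ?c)"
      using L by (intro integrable_mult_left integrable_real_indicator) (auto simp: cube_borel emeasure_cube)
    show "indicator (cube L) x *\<^sub>R (LINT \<zeta>|lborel. \<bar>indicator E (x + \<zeta>) - indicator E x\<bar> * K1 \<zeta>)
        \<le> indicator (cube L) x * ?c" for x
      using inner[of x] by (simp add: indicator_def)
    show "0 \<le> indicator (cube L) x * ?c" for x
      by (intro mult_nonneg_nonneg integral_nonneg) (auto simp: kern_nonneg)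
  qed
  also have "\<dots> = L ^ CARD('n) * ?c"
    using L by (simp add: measure_def emeasure_cube cube_borel)
  finally show ?thesis .
qed

lemma Ftilde_stripe_lower_bound:
  fixes E :: "(real^'n::finite) set"
  assumes n: "CARD('n) \<ge> 2" and L: "L > 0" and "J \<ge> 0" and E: "stripe_union E"
  shows "- (\<integral>(\<zeta>::real^'n). kern 1 \<zeta> \<partial>lborel) \<le> Ftilde J L E"
proof -
  have "0 \<le> J * Per1 E L"
    using stripe_union_Per1_nonneg[OF E L] \<open>J \<ge> 0\<close> by simp
  then have "- (L ^ CARD('n) * (\<integral>(\<zeta>::real^'n). kern 1 \<zeta> \<partial>lborel)) \<le> J * Per1 E L - nonlocal K1 E L"
    using nonlocal_K1_le[OF n L, of E] by simp
  then show ?thesis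
    unfolding Ftilde_def using L by (simp add: pos_le_divide_eq mult.commute)
qed

lemma periodic_Eh: "periodic_set (2 * h) (Eh h :: (real^'n::finite) set)"
  unfolding periodic_set_def
proof (intro allI)
  fix x :: "real^'n" and j :: 'n
  have "s + 2 * h \<in> stripes h \<longleftrightarrow> s \<in> stripes h" for s
  proof
    assume "s \<in> stripes h"
    then obtain i :: int where "2 * of_int i * h \<le> s" "s \<le> (2 * of_int i + 1) * h"
      unfolding stripes_def by blast
    then show "s + 2 * h \<in> stripes h"
      unfolding stripes_def by (auto intro!: exI[of _ "i + 1"] simp: algebra_simps)
  next
    assume "s + 2 * h \<in> stripes h"
    then obtain i :: int where "2 * of_int i * h \<le> s + 2 * h" "s + 2 * h \<le> (2 * of_int i + 1) * h"
      unfolding stripes_def by blast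
    then show "s \<in> stripes h"
      unfolding stripes_def by (auto intro!: exI[of _ "i - 1"] simp: algebra_simps)
  qed
  moreover have "(x + (2 * h) *\<^sub>R axis j 1) $ dir1 = (if j = dir1 then x $ dir1 + 2 * h else x $ dir1)"
    by (simp add: axis_def)
  ultimately show "x \<in> Eh h \<longleftrightarrow> x + (2 * h) *\<^sub>R axis j 1 \<in> Eh h"
    by (simp add: Eh_iff)
qed

lemma stripe_union_Eh:
  assumes h: "h > 0"
  shows "stripe_union (Eh h :: (real^'n::finite) set)"
  unfolding stripe_union_def
proof (intro exI conjI)
  let ?I = "\<lambda>j::int. {2 * of_int j * h .. (2 * of_int j + 1) * h}"
  show "loc_fin_union_intervals (stripes h)"
    unfolding loc_fin_union_intervals_def
  proof (intro exI[of _ "range ?I"] conjI allI ballI)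
    show "stripes h = \<Union>(range ?I)"
      by (auto simp: stripes_def)
    fix r :: real
    have "{I \<in> range ?I. I \<inter> {-r..r} \<noteq> {}} \<subseteq> ?I ` {\<lfloor>- r / h\<rfloor> - 1 .. \<lceil>r / h\<rceil>}"
    proof
      fix I assume "I \<in> {I \<in> range ?I. I \<inter> {-r..r} \<noteq> {}}"
      then obtain j where j: "I = ?I j" and "I \<inter> {-r..r} \<noteq> {}"
        by blast
      then obtain s where "s \<in> ?I j" "s \<in> {-r..r}"
        by blast
      then have s: "2 * of_int j * h \<le> s" "s \<le> (2 * of_int j + 1) * h" "-r \<le> s" "s \<le> r"
        by auto
      have "2 * of_int j * h \<le> r" "- r \<le> (2 * of_int j + 1) * h"
        using s by linarith+
      then have "2 * of_int j \<le> r / h" "- r / h \<le> 2 * of_int j + 1"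
        using h by (simp_all add: field_simps)
      \<comment> \<open>The sign of \<open>r / h\<close> turns the bounds on \<open>2 * j\<close>
        and \<open>2 * j + 1\<close> into the cruder bounds on \<open>j\<close> in the index
        range.\<close>
      moreover have "r / h \<ge> 0"
        using s h by simp
      ultimately have "j \<in> {\<lfloor>- r / h\<rfloor> - 1 .. \<lceil>r / h\<rceil>}"
        by simp linarith
      then show "I \<in> ?I ` {\<lfloor>- r / h\<rfloor> - 1 .. \<lceil>r / h\<rceil>}"
        unfolding j by (rule imageI)
    qed
    then show "finite {I \<in> range ?I. I \<inter> {-r..r} \<noteq> {}}"
      by (rule finite_subset) simp
  qed auto
  have "(Eh h :: (real^'n) set) = {x. x $ dir1 \<in> stripes h}"
    by (auto simp: Eh_iff)
  then show "(Eh h - {x. x $ dir1 \<in> stripes h}) \<union> ({x. x $ dir1 \<in> stripes h} - Eh h)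
      \<in> null_sets (lborel :: (real^'n) measure)"
    by simp
qed

text \<open>\<open>J\<close> is left free so that one computation serves both \<open>Ftilde\<close>,
  with \<open>m = 1\<close>, and \<open>FM\<close>, with \<open>m = M\<close>.\<close>

lemma Eh_energy:
  assumes m: "m > 0" and h: "h > 0" and n: "CARD('n::finite) \<ge> 2"
  shows "(J * Per1 (Eh h :: (real^'n) set) (2 * h) - nonlocal (kern m) (Eh h :: (real^'n) set) (2 * h)) / (2 * h) ^ CARD('n)
    = (J - stripe_energy (CARD('n) - 2) m h) / h"
proof -
  have "CARD('n) = Suc (CARD('n) - 1)" using n by simp
  then have p: "(2 * h) ^ CARD('n) = 2 * h * (2 * h) ^ (CARD('n) - 1)"
    by (metis power_Suc)
  have q: "(2 * h) ^ (CARD('n) - 1) > 0" using h by simp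
  have "J * Per1 (Eh h :: (real^'n) set) (2 * h) - nonlocal (kern m) (Eh h :: (real^'n) set) (2 * h)
      = (2 * h) ^ (CARD('n) - 1) * (2 * (J - stripe_energy (CARD('n) - 2) m h))"
    unfolding Per1_Eh[OF h] nonlocal_Eh[OF m h n] by (simp add: algebra_simps)
  moreover have "Q * (2 * D) / (2 * h * Q) = D / h" if "Q > 0" for Q D :: real
    using that h by (simp add: field_simps)
  ultimately show ?thesis
    unfolding p using q by metis
qed

text \<open>The trial width is \<open>M\<close> because \<open>Jtilde\<close> is the moment cut off
  at \<open>M\<close>, and \<open>cutoff_moment_bounds\<close> compares cutoff and width at the same
  value. The lower bound over all competitors is what makes \<open>cInf_lower\<close>
  applicable.\<close>

lemma estar_neg:
  assumes M: "M > 0" and n: "CARD('n::finite) \<ge> 2"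
  shows "estar TYPE('n) M < 0"
proof -
  let ?X = "{Ftilde (Jtilde TYPE('n) M) L E | L (E::(real^'n) set). L > 0 \<and> periodic_set L E \<and> stripe_union E}"
  have J: "Jtilde TYPE('n) M = cutoff_moment (CARD('n) - 2) 1 M"
    by (rule Jtilde_eq[OF M n])
  note J_bounds = cutoff_moment_bounds[of 1 M "CARD('n) - 2", folded J]
  have "Ftilde (Jtilde TYPE('n) M) (2 * M) (Eh M :: (real^'n) set)
      = (Jtilde TYPE('n) M - stripe_energy (CARD('n) - 2) 1 M) / M"
    unfolding Ftilde_def K1_eq_kern by (rule Eh_energy) (use M n in auto)
  also have "\<dots> < 0"
    using J_bounds(2) M by (simp add: divide_neg_pos)
  finally have neg: "Ftilde (Jtilde TYPE('n) M) (2 * M) (Eh M :: (real^'n) set) < 0" .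
  have "estar TYPE('n) M \<le> Ftilde (Jtilde TYPE('n) M) (2 * M) (Eh M :: (real^'n) set)"
    unfolding estar_def
  proof (rule cInf_lower)
    show "Ftilde (Jtilde TYPE('n) M) (2 * M) (Eh M :: (real^'n) set) \<in> ?X"
      using M periodic_Eh[of M, where ?'n='n] stripe_union_Eh[OF M, where ?'n='n]
      by (intro CollectI exI[of _ "2 * M"] exI[of _ "Eh M"]) simp
    show "bdd_below ?X"
    proof (rule bdd_belowI)
      fix y assume "y \<in> ?X"
      then obtain L and E :: "(real^'n) set" where "y = Ftilde (Jtilde TYPE('n) M) L E" "L > 0" "stripe_union E"
        by blast
      then show "- (\<integral>(\<zeta>::real^'n). kern 1 \<zeta> \<partial>lborel) \<le> y"
        using Ftilde_stripe_lower_bound[OF n _ _ \<open>stripe_union E\<close>] J_bounds(1) M by simp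
    qed
  qed
  with neg show ?thesis by simp
qed

section \<open>Reduction of \<open>eM\<close> to one variable and conclusion\<close>

lemma Kbar_eq_kern: "Kbar TYPE('n::finite) M = (\<lambda>\<zeta>. - 1 / estar TYPE('n) M * kern M \<zeta>)"
  by (simp add: Kbar_def kern_def fun_eq_iff)

text \<open>Real constants leave Bochner integrals unconditionally, since for a nonzero constant the
  non-integrable case gives 0 on both sides.\<close>

lemma nonlocal_cmult: "nonlocal (\<lambda>\<zeta>. c * K \<zeta>) E L = c * nonlocal K E L"
proof -
  have "nonlocal (\<lambda>\<zeta>. c * K \<zeta>) E L
      = (LINT x:cube L|lborel. c * (LINT \<zeta>|lborel. \<bar>indicator E (x + \<zeta>) - indicator E x\<bar> * K \<zeta>))"
    unfolding nonlocal_def by (subst integral_mult_right_zero[symmetric]) (simp add: mult_ac)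
  then show ?thesis
    unfolding nonlocal_def by simp
qed

lemma eM_eq:
  assumes M: "M > 0" and h: "h > 0" and n: "CARD('n::finite) \<ge> 2"
  shows "eM TYPE('n) M h = M\<^sup>2 * (- 1 / estar TYPE('n) M)
    * ((cutoff_moment (CARD('n) - 2) M 1 - stripe_energy (CARD('n) - 2) M h) / h)"
proof -
  let ?c = "- 1 / estar TYPE('n) M"
  have "JM TYPE('n) M = (\<integral>\<zeta>. ?c * (indicator {\<zeta>::real^'n. \<bar>\<zeta> $ dir1\<bar> \<le> 1} \<zeta> * \<bar>\<zeta> $ dir1\<bar> * kern M \<zeta>) \<partial>lborel)"
    unfolding JM_def Kbar_eq_kern by (simp add: mult_ac)
  also have "\<dots> = ?c * cutoff_moment (CARD('n) - 2) M 1"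
    unfolding integral_mult_right_zero using integral_cutoff_kern[OF M zero_less_one n, of dir1] by simp
  finally have J: "JM TYPE('n) M = ?c * cutoff_moment (CARD('n) - 2) M 1" .
  have "eM TYPE('n) M h = M\<^sup>2 * ?c * ((cutoff_moment (CARD('n) - 2) M 1 * Per1 (Eh h :: (real^'n) set) (2 * h)
      - nonlocal (kern M) (Eh h :: (real^'n) set) (2 * h)) / (2 * h) ^ CARD('n))"
    unfolding eM_def FM_def J Kbar_eq_kern nonlocal_cmult by (simp add: algebra_simps diff_divide_distrib)
  then show ?thesis
    unfolding Eh_energy[OF M h n] .
qed

theorem theorem3p1:
  assumes "CARD('n::finite) \<ge> 2"
  shows "\<exists>Mt>0. \<forall>M>Mt. \<exists>!h. 0 < h \<and> (\<forall>h'>0. eM TYPE('n) M h \<le> eM TYPE('n) M h')"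
\<comment> \<open>The threshold 1 is an arbitrary positive choice; the argument uses only
  \<open>M > 0\<close>.\<close>
proof (intro exI[of _ 1] conjI allI impI)
  fix M :: real assume "M > 1"
  then have M: "M > 0" by simp
  let ?k = "CARD('n) - 2"
  let ?J = "cutoff_moment ?k M 1" and ?T = "stripe_energy ?k M"
  have c: "M\<^sup>2 * (- 1 / estar TYPE('n) M) > 0"
    using M estar_neg[OF M assms] by (intro mult_pos_pos divide_neg_neg) auto
  obtain C P where CP: "C > 0" "P > 0" "\<And>h h'. \<bar>?T h - ?T h'\<bar> \<le> C * \<bar>h - h'\<bar>" "\<And>h. ?T h \<le> P"
    using stripe_energy_bounds[OF M, of ?k] by blast
  have "?T 0 = 0"
    by (simp add: stripe_energy_def)
  then have "\<exists>!h. 0 < h \<and> (\<forall>h'>0. (?J - ?T h) / h \<le> (?J - ?T h') / h')"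
    using cutoff_moment_bounds[OF M zero_less_one, of ?k] stripe_energy_midpoint[OF M, of _ _ ?k] CP
    \<comment> \<open>Width 1 is the reference width because \<open>JM\<close> is cut off at
      distance 1.\<close>
    by (intro unique_minimizer[where R=1 and C=C and P=P]) auto
  moreover have "eM TYPE('n) M h \<le> eM TYPE('n) M h' \<longleftrightarrow> (?J - ?T h) / h \<le> (?J - ?T h') / h'" if "0 < h" "0 < h'" for h h'
    unfolding eM_eq[OF M that(1) assms] eM_eq[OF M that(2) assms] using c by (rule mult_le_cancel_left_pos)
  ultimately show "\<exists>!h. 0 < h \<and> (\<forall>h'>0. eM TYPE('n) M h \<le> eM TYPE('n) M h')"
    by (smt (verit))
qed simp

end
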